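(* Let $n\ge1$ and $k\ge0$. The trivial representation of $S_{n}$ occurs with multiplicity $\binom{n-k}{k}$ in $H_{k}\big(\mathrm{cell}(n,2);\mathbb{Q}\big)$ if $n\ge 2k$, and with multiplicity $0$ otherwise.
   Context: A symbol on $[n]=\{1,\dots,n\}$ is a sequence $\alpha_1|\cdots|\alpha_r$ of nonempty blocks, each a string of labels, with every element of $[n]$ occurring exactly once. $\mathrm{cell}(n)$ is the polyhedral cell complex with one cell of dimension $n-r$ for each symbol with $r$ blocks; $f$ is a face of $g$ iff the symbol of $g$ is obtained from that of $f$ by deleting bars and shuffling the merged blocks (keeping the internal order of each original block). $\mathrm{cell}(n,2)$ is the subcomplex of cells all of whose blocks have at most $2$ elements. The boundary of a one-block cell $g$ is $\sum \pm\,\alpha|\beta$ over all ways to split $g$ into two complementary nonempty subwords $\alpha,\beta$, the sign being that of the permutation taking the word $g$ to the word $\alpha\beta$; and $\partial(g_1|g_2)=\partial g_1|g_2+(-1)^{b(g_1)}g_1|\partial g_2$ with $b$ the number of blocks. $S_n$ acts by permuting labels, so $H_k(\mathrm{cell}(n,2);\mathbb{Q})$ is an $S_n$-representation. *)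

theory Defs
  imports Complex_Main "HOL-Library.Poly_Mapping" "HOL-Algebra.Sym_Groups" "HOL-Algebra.AbelCoset"
    "HOL-Algebra.Module"
begin

section \<open>Linear algebra over the rationals\<close>

definition rat_field :: "rat ring" where
  "rat_field = \<lparr>carrier = UNIV, monoid.mult = (*), one = 1, zero = 0, add = (+)\<rparr>"

lemma field_rat_field: "field rat_field"
proof (rule cring.cring_fieldI2)
  show "cring rat_field"
    by unfold_locales (auto simp: rat_field_def algebra_simps Units_def intro: exI[of _ "- _"])
qed (auto simp: rat_field_def intro: right_inverse)

text \<open>The slots \<open>mult\<close> and \<open>one\<close> of a \<open>module\<close> record carry no meaning for modules and are
  left undefined below.\<close>

text \<open>Quotient of a module by a submodule: its elements are the cosets of \<open>N\<close>, and
  \<open>r \<cdot> (N + x) = N + r \<cdot> x\<close>.\<close>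

definition quotient_module :: "('a, 'b, 'c) module_scheme \<Rightarrow> 'b set \<Rightarrow> ('a, 'b set) module" where
  "quotient_module M N =
     \<lparr>carrier = a_rcosets\<^bsub>M\<^esub> N, monoid.mult = undefined, one = undefined,
      zero = N, add = set_add M,
      smult = (\<lambda>r X. \<Union>x\<in>X. N +>\<^bsub>M\<^esub> (r \<odot>\<^bsub>M\<^esub> x))\<rparr>"

definition scale :: "rat \<Rightarrow> ('s \<Rightarrow>\<^sub>0 rat) \<Rightarrow> ('s \<Rightarrow>\<^sub>0 rat)" where
  "scale r c = Poly_Mapping.map ((*) r) c"

definition linear_extension :: "('s \<Rightarrow> ('t \<Rightarrow>\<^sub>0 rat)) \<Rightarrow> ('s \<Rightarrow>\<^sub>0 rat) \<Rightarrow> ('t \<Rightarrow>\<^sub>0 rat)" where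
  "linear_extension f c = (\<Sum>s\<in>Poly_Mapping.keys c. scale (Poly_Mapping.lookup c s) (f s))"

lemma lookup_scale [simp]: "Poly_Mapping.lookup (scale r c) s = r * Poly_Mapping.lookup c s"
  by (simp add: scale_def Poly_Mapping.map.rep_eq when_def)

lemma scale_add: "scale r (c + d) = scale r c + scale r d"
  by (rule poly_mapping_eqI) (simp add: lookup_add algebra_simps)

lemma linear_extension_superset:
  assumes "finite A" "Poly_Mapping.keys c \<subseteq> A"
  shows "linear_extension f c = (\<Sum>s\<in>A. scale (Poly_Mapping.lookup c s) (f s))"
  unfolding linear_extension_def
proof (rule sum.mono_neutral_left)
  show "\<forall>s\<in>A - Poly_Mapping.keys c. scale (Poly_Mapping.lookup c s) (f s) = 0"
    by (auto intro!: poly_mapping_eqI simp: in_keys_iff)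
qed (use assms in auto)

lemma linear_extension_add:
  "linear_extension f (c + d) = linear_extension f c + linear_extension f d"
proof -
  let ?A = "Poly_Mapping.keys c \<union> Poly_Mapping.keys d"
  have "finite ?A" by simp
  moreover have "Poly_Mapping.keys (c + d) \<subseteq> ?A" by (rule Poly_Mapping.keys_add)
  ultimately have "linear_extension f (c + d)
      = (\<Sum>s\<in>?A. scale (Poly_Mapping.lookup (c + d) s) (f s))"
    by (rule linear_extension_superset)
  also have "\<dots> = (\<Sum>s\<in>?A. scale (Poly_Mapping.lookup c s) (f s) + scale (Poly_Mapping.lookup d s) (f s))"
    by (intro sum.cong refl poly_mapping_eqI) (simp add: lookup_add algebra_simps)
  also have "\<dots> = linear_extension f c + linear_extension f d"
    by (simp add: sum.distrib linear_extension_superset[of ?A])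
  finally show ?thesis .
qed

lemma linear_extension_single [simp]:
  "linear_extension f (Poly_Mapping.single s r) = scale r (f s)"
  by (subst linear_extension_superset[of "{s}"]) (auto simp: lookup_single)

lemma linear_extension_scale:
  "linear_extension f (scale r c) = scale r (linear_extension f c)"
proof -
  have "Poly_Mapping.keys (scale r c) \<subseteq> Poly_Mapping.keys c"
    by (auto simp: in_keys_iff)
  then have "linear_extension f (scale r c) =
      (\<Sum>s\<in>Poly_Mapping.keys c. scale (Poly_Mapping.lookup (scale r c) s) (f s))"
    by (intro linear_extension_superset) auto
  then show ?thesis
    by (auto intro!: poly_mapping_eqI simp: linear_extension_def lookup_sum sum_distrib_left mult.assoc)
qed

lemma scale_one [simp]: "scale 1 c = c"
  by (rule poly_mapping_eqI) simp

lemma scale_minus_one: "scale (- 1) c = - c"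
  by (rule poly_mapping_eqI) simp

lemma scale_scale [simp]: "scale q (scale r c) = scale (q * r) c"
  by (rule poly_mapping_eqI) simp

lemma chain_induct [case_names zero single add]:
  assumes "P 0" "\<And>s r. P (Poly_Mapping.single s r)" "\<And>c d. P c \<Longrightarrow> P d \<Longrightarrow> P (c + d)"
  shows "P (c :: 's \<Rightarrow>\<^sub>0 rat)"
proof -
  have "P (\<Sum>s\<in>A. Poly_Mapping.single s (Poly_Mapping.lookup c s))" if "finite A" for A
    using that by induction (auto intro: assms)
  moreover have "(\<Sum>s\<in>Poly_Mapping.keys c. Poly_Mapping.single s (Poly_Mapping.lookup c s)) = c"
    by (rule poly_mapping_eqI)
      (auto simp: lookup_sum lookup_single when_def sum.If_cases in_keys_iff sum.delta)
  ultimately show ?thesis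
    using finite_keys[of c] by metis
qed

text \<open>The rational vector space with basis \<open>S\<close>.\<close>

definition free_module :: "'s set \<Rightarrow> (rat, 's \<Rightarrow>\<^sub>0 rat) module" where
  "free_module S =
     \<lparr>carrier = {c. Poly_Mapping.keys c \<subseteq> S}, monoid.mult = undefined, one = undefined,
      zero = 0, add = (+), smult = scale\<rparr>"


section \<open>Representations and multiplicities\<close>

locale group_representation =
  K: field K + V: module K V + G: group G
  for K :: "('a, 'x) ring_scheme" (structure)
    and V :: "('a, 'v, 'y) module_scheme" (structure)
    and G :: "('g, 'z) monoid_scheme" (structure) +
  fixes \<rho> :: "'g \<Rightarrow> 'v \<Rightarrow> 'v"
  assumes act_closed:
      "\<lbrakk>g \<in> carrier G; v \<in> carrier V\<rbrakk> \<Longrightarrow> \<rho> g v \<in> carrier V"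
    and act_add:
      "\<lbrakk>g \<in> carrier G; v \<in> carrier V; w \<in> carrier V\<rbrakk>
        \<Longrightarrow> \<rho> g (v \<oplus>\<^bsub>V\<^esub> w) = \<rho> g v \<oplus>\<^bsub>V\<^esub> \<rho> g w"
    and act_smult:
      "\<lbrakk>g \<in> carrier G; r \<in> carrier K; v \<in> carrier V\<rbrakk>
        \<Longrightarrow> \<rho> g (r \<odot>\<^bsub>V\<^esub> v) = r \<odot>\<^bsub>V\<^esub> \<rho> g v"
    and act_one:
      "v \<in> carrier V \<Longrightarrow> \<rho> \<one>\<^bsub>G\<^esub> v = v"
    and act_mult:
      "\<lbrakk>g \<in> carrier G; h \<in> carrier G; v \<in> carrier V\<rbrakk>
        \<Longrightarrow> \<rho> (g \<otimes>\<^bsub>G\<^esub> h) v = \<rho> g (\<rho> h v)"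

text \<open>A subrepresentation is given by its underlying set \<open>U\<close>; as a representation in its own
  right it is \<open>V\<lparr>carrier := U\<rparr>\<close> with the same action.\<close>

definition subrepresentation ::
  "('a, 'x) ring_scheme \<Rightarrow> ('g, 'z) monoid_scheme \<Rightarrow> ('a, 'v, 'y) module_scheme
    \<Rightarrow> ('g \<Rightarrow> 'v \<Rightarrow> 'v) \<Rightarrow> 'v set \<Rightarrow> bool" where
  "subrepresentation K G V \<rho> U \<longleftrightarrow>
     submodule U K V \<and> (\<forall>g\<in>carrier G. \<forall>u\<in>U. \<rho> g u \<in> U)"

definition irreducible_subrepresentation ::
  "('a, 'x) ring_scheme \<Rightarrow> ('g, 'z) monoid_scheme \<Rightarrow> ('a, 'v, 'y) module_scheme
    \<Rightarrow> ('g \<Rightarrow> 'v \<Rightarrow> 'v) \<Rightarrow> 'v set \<Rightarrow> bool" where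
  "irreducible_subrepresentation K G V \<rho> U \<longleftrightarrow>
     subrepresentation K G V \<rho> U \<and> U \<noteq> {\<zero>\<^bsub>V\<^esub>} \<and>
     (\<forall>U'. subrepresentation K G V \<rho> U' \<and> U' \<subseteq> U \<longrightarrow> U' = {\<zero>\<^bsub>V\<^esub>} \<or> U' = U)"

definition isomorphic_representations ::
  "('a, 'x) ring_scheme \<Rightarrow> ('g, 'z) monoid_scheme
    \<Rightarrow> ('a, 'v, 'y) module_scheme \<Rightarrow> ('g \<Rightarrow> 'v \<Rightarrow> 'v)
    \<Rightarrow> ('a, 'w, 'u) module_scheme \<Rightarrow> ('g \<Rightarrow> 'w \<Rightarrow> 'w) \<Rightarrow> bool" where
  "isomorphic_representations K G V \<rho> W \<sigma> \<longleftrightarrow>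
     (\<exists>f. bij_betw f (carrier V) (carrier W) \<and>
          (\<forall>v\<in>carrier V. \<forall>v'\<in>carrier V. f (v \<oplus>\<^bsub>V\<^esub> v') = f v \<oplus>\<^bsub>W\<^esub> f v') \<and>
          (\<forall>r\<in>carrier K. \<forall>v\<in>carrier V. f (r \<odot>\<^bsub>V\<^esub> v) = r \<odot>\<^bsub>W\<^esub> f v) \<and>
          (\<forall>g\<in>carrier G. \<forall>v\<in>carrier V. f (\<rho> g v) = \<sigma> g (f v)))"

text \<open>Internal direct sum decompositions into irreducibles. The summands are nonzero, hence
  pairwise distinct, so a set (rather than a family) of them loses no information.\<close>

definition irreducible_decomposition ::
  "('a, 'x) ring_scheme \<Rightarrow> ('g, 'z) monoid_scheme \<Rightarrow> ('a, 'v, 'y) module_scheme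
    \<Rightarrow> ('g \<Rightarrow> 'v \<Rightarrow> 'v) \<Rightarrow> 'v set set \<Rightarrow> bool" where
  "irreducible_decomposition K G V \<rho> \<U> \<longleftrightarrow>
     finite \<U> \<and> (\<forall>U\<in>\<U>. irreducible_subrepresentation K G V \<rho> U) \<and>
     (\<forall>v\<in>carrier V. \<exists>!u. u \<in> (\<Pi>\<^sub>E U\<in>\<U>. U) \<and> v = finsum V u \<U>)"

text \<open>\<open>W\<close> occurs in \<open>V\<close> with multiplicity \<open>m\<close>: \<open>V\<close> is a finite direct sum of irreducibles, and
  in every such decomposition exactly \<open>m\<close> summands are isomorphic to \<open>W\<close>.\<close>

definition occurs_with_multiplicity ::
  "('a, 'x) ring_scheme \<Rightarrow> ('g, 'z) monoid_scheme
    \<Rightarrow> ('a, 'w, 'u) module_scheme \<Rightarrow> ('g \<Rightarrow> 'w \<Rightarrow> 'w)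
    \<Rightarrow> ('a, 'v, 'y) module_scheme \<Rightarrow> ('g \<Rightarrow> 'v \<Rightarrow> 'v) \<Rightarrow> nat \<Rightarrow> bool" where
  "occurs_with_multiplicity K G W \<sigma> V \<rho> m \<longleftrightarrow>
     group_representation K W G \<sigma> \<and> group_representation K V G \<rho> \<and>
     (\<exists>\<U>. irreducible_decomposition K G V \<rho> \<U>) \<and>
     (\<forall>\<U>. irreducible_decomposition K G V \<rho> \<U> \<longrightarrow>
        card {U \<in> \<U>. isomorphic_representations K G (V\<lparr>carrier := U\<rparr>) \<rho> W \<sigma>} = m)"

definition trivial_rep_space :: "(rat, rat) module" where
  "trivial_rep_space =
     \<lparr>carrier = UNIV, monoid.mult = undefined, one = undefined,
      zero = 0, add = (+), smult = (*)\<rparr>"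

definition trivial_action :: "'g \<Rightarrow> rat \<Rightarrow> rat" where
  "trivial_action g x = x"


section \<open>The complexes \<open>cell(n,w)\<close>\<close>

type_synonym block = "nat list"
type_synonym symbol = "block list"
type_synonym chain = "symbol \<Rightarrow>\<^sub>0 rat"

definition symbols :: "nat \<Rightarrow> symbol set" where
  "symbols n = {s. [] \<notin> set s \<and> distinct (concat s) \<and> set (concat s) = {1..n}}"

text \<open>The \<open>k\<close>-dimensional cells of \<open>cell(n,w)\<close>. Dimension \<open>k = n - r\<close> is written \<open>r + k = n\<close> to
  avoid truncated subtraction.\<close>

definition cells :: "nat \<Rightarrow> nat \<Rightarrow> nat \<Rightarrow> symbol set" where
  "cells n w k = {s \<in> symbols n. length s + k = n \<and> (\<forall>b\<in>set s. length b \<le> w)}"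

text \<open>Pairs of complementary nonempty subwords of \<open>g\<close>. For \<open>g\<close> without repeated letters, two
  words are complementary subwords of \<open>g\<close> iff \<open>g\<close> is one of their shuffles.\<close>

definition block_splits :: "block \<Rightarrow> (block \<times> block) set" where
  "block_splits g = {(\<alpha>, \<beta>). \<alpha> \<noteq> [] \<and> \<beta> \<noteq> [] \<and> g \<in> shuffles \<alpha> \<beta>}"

lemma finite_block_splits: "finite (block_splits g)"
proof (rule finite_subset)
  let ?L = "{xs. set xs \<subseteq> set g \<and> length xs \<le> length g}"
  show "block_splits g \<subseteq> ?L \<times> ?L"
    by (auto simp: block_splits_def dest: set_shuffles length_shuffles)
  show "finite (?L \<times> ?L)"
    by (simp add: finite_lists_length_le)
qed

text \<open>Meaningful for words \<open>g\<close>, \<open>h\<close> without repetitions on the same letters, when the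
  permutation below exists and is unique.\<close>

definition word_sign :: "block \<Rightarrow> block \<Rightarrow> int" where
  "word_sign g h = sign (THE p. p permutes set g \<and> map p g = h)"

definition block_boundary :: "block \<Rightarrow> chain" where
  "block_boundary g =
     (\<Sum>(\<alpha>, \<beta>)\<in>block_splits g.
        Poly_Mapping.single [\<alpha>, \<beta>] (of_int (word_sign g (\<alpha> @ \<beta>))))"

text \<open>Bilinear extension of \<open>(s, t) \<mapsto> s | t\<close>.\<close>

definition bar :: "chain \<Rightarrow> chain \<Rightarrow> chain" where
  "bar c d = linear_extension
     (\<lambda>s. linear_extension (\<lambda>t. Poly_Mapping.single (s @ t) 1) d) c"

lemma linear_extension_diff:
  "linear_extension f (c - d) = linear_extension f c - linear_extension f d"
  by (metis add_diff_cancel_right' diff_add_cancel linear_extension_add)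

lemma bar_single_single [simp]:
  "bar (Poly_Mapping.single s q) (Poly_Mapping.single t r) = Poly_Mapping.single (s @ t) (q * r)"
  by (auto intro!: poly_mapping_eqI simp: bar_def lookup_single when_def)

lemma bar_add_left: "bar (c + c') d = bar c d + bar c' d"
  by (simp add: bar_def linear_extension_add)

lemma bar_add_right: "bar c (d + d') = bar c d + bar c d'"
  by (induction c rule: chain_induct)
    (simp_all add: bar_def linear_extension_add scale_add linear_extension_def[of _ 0])

lemma bar_zero_left [simp]: "bar 0 d = 0"
  by (simp add: bar_def linear_extension_def)

lemma bar_zero_right [simp]: "bar c 0 = 0"
  using bar_add_right[of c 0 0] by simp

lemma bar_diff_left: "bar (c - c') d = bar c d - bar c' d"
  by (metis add_diff_cancel_right' diff_add_cancel bar_add_left)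

lemma bar_scale_right: "bar c (scale r d) = scale r (bar c d)"
proof (induction c rule: chain_induct)
  case zero
  show ?case by (auto intro: poly_mapping_eqI)
next
  case (single s q)
  show ?case by (simp add: bar_def linear_extension_scale mult.commute)
next
  case (add c c')
  then show ?case by (simp add: bar_add_left scale_add)
qed

lemma bar_assoc: "bar (bar c d) e = bar c (bar d e)"
proof (induction c rule: chain_induct)
  case (single s q)
  show ?case
  proof (induction d rule: chain_induct)
    case (single t r)
    show ?case
      by (induction e rule: chain_induct) (simp_all add: bar_add_right mult.assoc)
  qed (simp_all add: bar_add_left bar_add_right)
qed (simp_all add: bar_add_left)

lemma bar_Nil_left [simp]: "bar (Poly_Mapping.single [] 1) c = c"
  by (induction c rule: chain_induct) (simp_all add: bar_add_right)

text \<open>The Leibniz rule \<open>\<partial>(g\<^sub>1 | g\<^sub>2) = \<partial>g\<^sub>1 | g\<^sub>2 + (-1)\<^bsup>b(g\<^sub>1)\<^esup> g\<^sub>1 | \<partial>g\<^sub>2\<close> with \<open>g\<^sub>1\<close> the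
  first block; the rule for general \<open>g\<^sub>1\<close> is \<open>symbol_boundary_append\<close> below.\<close>

fun symbol_boundary :: "symbol \<Rightarrow> chain" where
  "symbol_boundary [] = 0"
| "symbol_boundary (g # s) =
     bar (block_boundary g) (Poly_Mapping.single s 1)
     - bar (Poly_Mapping.single [g] 1) (symbol_boundary s)"

lemma symbol_boundary_append:
  "symbol_boundary (s @ t) =
     bar (symbol_boundary s) (Poly_Mapping.single t 1)
     + scale ((- 1) ^ length s) (bar (Poly_Mapping.single s 1) (symbol_boundary t))"
proof (induction s)
  case Nil
  show ?case by simp
next
  case (Cons g s)
  have sg: "Poly_Mapping.single (g # s) 1
      = bar (Poly_Mapping.single [g] 1) (Poly_Mapping.single s (1 :: rat))"
    by simp
  have st: "Poly_Mapping.single (s @ t) 1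
      = bar (Poly_Mapping.single s 1) (Poly_Mapping.single t (1 :: rat))"
    by simp
  have neg: "scale ((- 1) ^ length (g # s)) c = - scale ((- 1) ^ length s) c" for c :: chain
    by (rule poly_mapping_eqI) simp
  show ?case
    unfolding append_Cons symbol_boundary.simps Cons.IH neg sg st
    by (simp only: bar_add_right bar_diff_left bar_assoc bar_scale_right) (simp add: algebra_simps)
qed

definition boundary :: "chain \<Rightarrow> chain" where
  "boundary = linear_extension symbol_boundary"

definition chains :: "nat \<Rightarrow> nat \<Rightarrow> nat \<Rightarrow> (rat, chain) module" where
  "chains n w k = free_module (cells n w k)"

text \<open>The boundary of every \<open>0\<close>-cell is \<open>0\<close>, since one-letter blocks have no splits; so degree
  \<open>0\<close> needs no special treatment.\<close>

definition cycles :: "nat \<Rightarrow> nat \<Rightarrow> nat \<Rightarrow> chain set" where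
  "cycles n w k = {c \<in> carrier (chains n w k). boundary c = 0}"

definition boundaries :: "nat \<Rightarrow> nat \<Rightarrow> nat \<Rightarrow> chain set" where
  "boundaries n w k = boundary ` carrier (chains n w (k + 1))"

text \<open>\<open>H\<^sub>k(cell(n,w); \<rat>)\<close> with the action of \<open>S\<^sub>n\<close> induced by relabelling.\<close>

definition homology :: "nat \<Rightarrow> nat \<Rightarrow> nat \<Rightarrow> (rat, chain set) module" where
  "homology n w k =
     quotient_module ((chains n w k)\<lparr>carrier := cycles n w k\<rparr>) (boundaries n w k)"

definition relabel :: "(nat \<Rightarrow> nat) \<Rightarrow> chain \<Rightarrow> chain" where
  "relabel p = linear_extension (\<lambda>s. Poly_Mapping.single (map (map p) s) 1)"

definition homology_action :: "(nat \<Rightarrow> nat) \<Rightarrow> chain set \<Rightarrow> chain set" where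
  "homology_action p X = relabel p ` X"

end

theory Submission
  imports Defs
begin

text \<open>
  Relabelling permutes the \<open>k\<close>-cells of \<open>cell(n,2)\<close>, and the orbit of a cell is determined by its
  sequence of block lengths. With blocks of length \<open>1\<close> and \<open>2\<close>, a \<open>k\<close>-cell has \<open>n - k\<close> blocks, of
  which \<open>k\<close> have length \<open>2\<close>; hence there are \<open>(n - k) choose k\<close> orbits, and this is the dimension
  of the invariants of the chain space (lemmas \<open>card_shapes\<close> and \<open>dim_invariant_chains\<close>).

  The boundary of a block \<open>ab\<close> is \<open>a|b - b|a\<close>, and the two faces lie in the same orbit, since the
  transposition of \<open>a\<close> and \<open>b\<close> exchanges them. So the differential vanishes on coinvariants
  (lemma \<open>boundary_in_coinvariant_kernel\<close>). Over \<open>\<rat>\<close> the multiplicity of the trivial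
  representation is the dimension of the invariants, which agree with the coinvariants and commute
  with homology; therefore the multiplicity in degree \<open>k\<close> is the number of orbits of \<open>k\<close>-cells.

  The passage to invariants is made explicit by the inner product on chains in which the symbols
  are orthonormal. It is invariant under relabelling, so orthogonal complements of
  subrepresentations are subrepresentations. This gives complete reducibility, and the multiplicity
  of the trivial representation is the dimension of the invariants (theorem
  \<open>trivial_multiplicity\<close>). It also identifies homology with the harmonic chains, the cycles
  orthogonal to all boundaries (lemma \<open>harmonic_isomorphism\<close>), and multiplicities are transported
  along this isomorphism (lemma \<open>multiplicity_transport\<close>). An invariant chain is a cycle and is
  orthogonal to all boundaries, both because boundaries vanish in coinvariants; so the invariants
  of homology are all the invariant chains.
\<close>


section \<open>Transport of multiplicities along isomorphisms\<close>

context group_representation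
begin

lemma subrepresentation_iff:
  "subrepresentation K G V \<rho> U \<longleftrightarrow>
     U \<subseteq> carrier V \<and> \<zero>\<^bsub>V\<^esub> \<in> U \<and> (\<forall>x\<in>U. \<forall>y\<in>U. x \<oplus>\<^bsub>V\<^esub> y \<in> U) \<and>
     (\<forall>r\<in>carrier K. \<forall>x\<in>U. r \<odot>\<^bsub>V\<^esub> x \<in> U) \<and> (\<forall>g\<in>carrier G. \<forall>x\<in>U. \<rho> g x \<in> U)"
  (is "_ \<longleftrightarrow> ?R")
proof
  assume *: "subrepresentation K G V \<rho> U"
  then have sm: "submodule U K V" by (simp add: subrepresentation_def)
  note E = V.submoduleE[OF sm]
  from E(2) obtain x where x: "x \<in> U" by auto
  then have "\<zero>\<^bsub>K\<^esub> \<odot>\<^bsub>V\<^esub> x = \<zero>\<^bsub>V\<^esub>" using E(1) by auto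
  then have "\<zero>\<^bsub>V\<^esub> \<in> U" using E(4)[OF _ x, of "\<zero>\<^bsub>K\<^esub>"] by simp
  with * E show ?R by (auto simp: subrepresentation_def)
next
  assume R: ?R
  have "submodule U K V"
  proof (rule V.submoduleI)
    fix a assume a: "a \<in> U"
    with R have "\<ominus>\<^bsub>V\<^esub> a = (\<ominus>\<^bsub>K\<^esub> \<one>\<^bsub>K\<^esub>) \<odot>\<^bsub>V\<^esub> a"
      by (subst V.smult_l_minus) auto
    also have "\<dots> \<in> U" using R a by auto
    finally show "\<ominus>\<^bsub>V\<^esub> a \<in> U" .
  qed (use R in auto)
  with R show "subrepresentation K G V \<rho> U" by (simp add: subrepresentation_def)
qed

end

text \<open>The target \<open>W\<close> is a bare record of operations, which inherits the axioms of a
  representation from \<open>V\<close> along \<open>f\<close>. This is how the homology module, a record of cosets, obtains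
  its module structure.\<close>

locale representation_isomorphism =
  group_representation K V G \<rho>
  for K :: "('a, 'x) ring_scheme"
    and V :: "('a, 'v, 'y) module_scheme"
    and G :: "('g, 'z) monoid_scheme"
    and \<rho> :: "'g \<Rightarrow> 'v \<Rightarrow> 'v" +
  fixes W :: "('a, 'w, 'u) module_scheme"
    and \<sigma> :: "'g \<Rightarrow> 'w \<Rightarrow> 'w"
    and f :: "'v \<Rightarrow> 'w"
  assumes bij: "bij_betw f (carrier V) (carrier W)"
    and hom_zero: "f \<zero>\<^bsub>V\<^esub> = \<zero>\<^bsub>W\<^esub>"
    and hom_add: "\<lbrakk>x \<in> carrier V; y \<in> carrier V\<rbrakk> \<Longrightarrow> f (x \<oplus>\<^bsub>V\<^esub> y) = f x \<oplus>\<^bsub>W\<^esub> f y"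
    and hom_smult: "\<lbrakk>r \<in> carrier K; x \<in> carrier V\<rbrakk> \<Longrightarrow> f (r \<odot>\<^bsub>V\<^esub> x) = r \<odot>\<^bsub>W\<^esub> f x"
    and equivariant: "\<lbrakk>g \<in> carrier G; x \<in> carrier V\<rbrakk> \<Longrightarrow> f (\<rho> g x) = \<sigma> g (f x)"
begin

abbreviation finv :: "'w \<Rightarrow> 'v" where
  "finv \<equiv> inv_into (carrier V) f"

lemma f_closed [simp]: "x \<in> carrier V \<Longrightarrow> f x \<in> carrier W"
  using bij by (auto simp: bij_betw_def)

lemma inj_on_f: "inj_on f (carrier V)"
  using bij by (simp add: bij_betw_def)

lemma carrier_W: "carrier W = f ` carrier V"
  using bij by (simp add: bij_betw_def)

lemma finv_f [simp]: "x \<in> carrier V \<Longrightarrow> finv (f x) = x"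
  by (rule inv_into_f_f[OF inj_on_f])

lemma target_abelian_group: "abelian_group W"
proof (rule abelian_groupI)
  fix x assume "x \<in> carrier W"
  then obtain a where a: "a \<in> carrier V" "x = f a" by (auto simp: carrier_W)
  then have "f (\<ominus>\<^bsub>V\<^esub> a) \<oplus>\<^bsub>W\<^esub> x = \<zero>\<^bsub>W\<^esub>"
    by (simp add: V.l_neg hom_zero flip: hom_add)
  with a show "\<exists>y\<in>carrier W. y \<oplus>\<^bsub>W\<^esub> x = \<zero>\<^bsub>W\<^esub>" by (auto intro!: bexI[of _ "f (\<ominus>\<^bsub>V\<^esub> a)"])
qed (auto simp: carrier_W V.a_ac simp flip: hom_zero hom_add)

lemma target_module: "module K W"
proof (rule moduleI)
  show "cring K" by unfold_locales
  show "abelian_group W" by (rule target_abelian_group)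
qed (auto simp: carrier_W V.smult_l_distr V.smult_r_distr V.smult_assoc1
       simp flip: hom_add hom_smult)

lemma target_representation: "group_representation K W G \<sigma>"
proof -
  interpret W: module K W by (rule target_module)
  show ?thesis
    by unfold_locales
      (auto simp: carrier_W act_closed act_add act_smult act_one act_mult
        simp flip: hom_add hom_smult equivariant)
qed

sublocale W: group_representation K W G \<sigma>
  by (rule target_representation)

lemma inverse_isomorphism: "representation_isomorphism K W G \<sigma> V \<rho> finv"
proof
  show "bij_betw finv (carrier W) (carrier V)" by (rule bij_betw_inv_into[OF bij])
  show "finv \<zero>\<^bsub>W\<^esub> = \<zero>\<^bsub>V\<^esub>" by (simp flip: hom_zero)
qed (auto simp: carrier_W act_closed simp flip: hom_add hom_smult equivariant)

lemma subrepresentation_image: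
  assumes "subrepresentation K G V \<rho> U"
  shows "subrepresentation K G W \<sigma> (f ` U)"
  unfolding W.subrepresentation_iff
proof (intro conjI ballI)
  note U = assms[unfolded subrepresentation_iff]
  show "f ` U \<subseteq> carrier W" using U by auto
  show "\<zero>\<^bsub>W\<^esub> \<in> f ` U" using U by (metis hom_zero imageI)
  fix x assume "x \<in> f ` U"
  then obtain a where a: "a \<in> U" "a \<in> carrier V" "x = f a" using U by auto
  show "x \<oplus>\<^bsub>W\<^esub> y \<in> f ` U" if y: "y \<in> f ` U" for y
  proof -
    from y obtain b where "b \<in> U" "b \<in> carrier V" "y = f b" using U by auto
    with a U show ?thesis by (auto simp flip: hom_add)
  qed
  show "r \<odot>\<^bsub>W\<^esub> x \<in> f ` U" if "r \<in> carrier K" for r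
    using that a U by (auto simp flip: hom_smult)
  show "\<sigma> g x \<in> f ` U" if "g \<in> carrier G" for g
    using that a U by (auto simp flip: equivariant)
qed

lemma irreducible_image:
  assumes "irreducible_subrepresentation K G V \<rho> U"
  shows "irreducible_subrepresentation K G W \<sigma> (f ` U)"
  unfolding irreducible_subrepresentation_def
proof (intro conjI allI impI)
  interpret inv: representation_isomorphism K W G \<sigma> V \<rho> finv by (rule inverse_isomorphism)
  have U: "subrepresentation K G V \<rho> U" "U \<noteq> {\<zero>\<^bsub>V\<^esub>}"
    and min: "\<And>U'. subrepresentation K G V \<rho> U' \<Longrightarrow> U' \<subseteq> U \<Longrightarrow> U' = {\<zero>\<^bsub>V\<^esub>} \<or> U' = U"
    using assms by (auto simp: irreducible_subrepresentation_def)
  have sub: "U \<subseteq> carrier V" using U by (simp add: subrepresentation_iff)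
  have finv_image: "finv ` f ` U = U" using sub by force
  show "subrepresentation K G W \<sigma> (f ` U)" by (rule subrepresentation_image[OF U(1)])
  show "f ` U \<noteq> {\<zero>\<^bsub>W\<^esub>}" using U(2) finv_image by (metis image_empty image_insert inv.hom_zero)
  fix U' assume U': "subrepresentation K G W \<sigma> U' \<and> U' \<subseteq> f ` U"
  then have "finv ` U' \<subseteq> U" using finv_image by blast
  moreover have "f ` finv ` U' = U'"
    using U' carrier_W by (metis W.subrepresentation_iff image_inv_into_cancel)
  ultimately show "U' = {\<zero>\<^bsub>W\<^esub>} \<or> U' = f ` U"
    using min[OF inv.subrepresentation_image] U' by (metis hom_zero image_empty image_insert)
qed

lemma hom_finsum:
  assumes "u \<in> A \<rightarrow> carrier V"
  shows "f (finsum V u A) = finsum W (\<lambda>i. f (u i)) A"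
  using assms
proof (induction A rule: infinite_finite_induct)
  case (insert i A)
  then have "f (finsum V u (insert i A)) = f (u i \<oplus>\<^bsub>V\<^esub> finsum V u A)"
    by (subst V.finsum_insert) auto
  also have "\<dots> = f (u i) \<oplus>\<^bsub>W\<^esub> finsum W (\<lambda>i. f (u i)) A"
    using insert by (subst hom_add) (auto intro!: V.finsum_closed)
  also have "\<dots> = finsum W (\<lambda>i. f (u i)) (insert i A)"
    using insert by (subst W.V.finsum_insert) (auto simp: Pi_iff)
  finally show ?case .
qed (simp_all add: hom_zero)

text \<open>A family of components \<open>u\<close> indexed by the summands \<open>U\<close> corresponds to the family
  \<open>X \<mapsto> f (u (f\<inverse> X))\<close> indexed by the images \<open>X = f U\<close>, in both directions; so unique
  decomposability of \<open>v\<close> and of \<open>f v\<close> are the same statement.\<close>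

lemma decomposition_image:
  assumes "irreducible_decomposition K G V \<rho> \<U>"
  shows "irreducible_decomposition K G W \<sigma> ((`) f ` \<U>)"
  unfolding irreducible_decomposition_def
proof (intro conjI ballI)
  have fin: "finite \<U>"
    and irr: "\<And>U. U \<in> \<U> \<Longrightarrow> irreducible_subrepresentation K G V \<rho> U"
    and ex1: "\<And>v. v \<in> carrier V \<Longrightarrow> \<exists>!u. u \<in> (\<Pi>\<^sub>E U\<in>\<U>. U) \<and> v = finsum V u \<U>"
    using assms by (auto simp: irreducible_decomposition_def)
  show "finite ((`) f ` \<U>)" using fin by simp
  show "irreducible_subrepresentation K G W \<sigma> X" if "X \<in> (`) f ` \<U>" for X
    using that irr irreducible_image by auto
  have sub: "U \<subseteq> carrier V" if "U \<in> \<U>" for U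
    using irr[OF that] by (simp add: irreducible_subrepresentation_def subrepresentation_iff)
  have finv_image: "finv ` f ` U = U" if "U \<in> \<U>" for U
    using sub[OF that] by force
  have inj: "inj_on ((`) f) \<U>" by (metis finv_image inj_onI)
  fix w assume "w \<in> carrier W"
  then obtain v where v: "v \<in> carrier V" "w = f v" by (auto simp: carrier_W)
  have Pi: "u \<in> \<U> \<rightarrow> carrier V" if "\<And>U. U \<in> \<U> \<Longrightarrow> u U \<in> U" for u
    using that sub by blast
  have sum_image: "f (finsum V u \<U>) = finsum W (\<lambda>X. f (u (finv ` X))) ((`) f ` \<U>)"
    if u: "\<And>U. U \<in> \<U> \<Longrightarrow> u U \<in> U" for u
  proof -
    have uV: "u \<in> \<U> \<rightarrow> carrier V" by (rule Pi[OF u])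
    have "finsum W (\<lambda>X. f (u (finv ` X))) ((`) f ` \<U>) = finsum W (\<lambda>U. f (u (finv ` f ` U))) \<U>"
      using uV by (subst W.V.finsum_reindex[OF _ inj]) (auto simp: finv_image Pi_iff)
    also have "\<dots> = finsum W (\<lambda>U. f (u U)) \<U>"
      using uV by (intro W.V.finsum_cong') (auto simp: finv_image Pi_iff)
    finally show ?thesis using hom_finsum[OF uV] by simp
  qed
  obtain u where u: "u \<in> (\<Pi>\<^sub>E U\<in>\<U>. U)" "v = finsum V u \<U>"
    using ex1[OF v(1)] by blast
  show "\<exists>!x. x \<in> (\<Pi>\<^sub>E X\<in>(`) f ` \<U>. X) \<and> w = finsum W x ((`) f ` \<U>)"
  proof (rule ex1I)
    let ?x = "\<lambda>X\<in>(`) f ` \<U>. f (u (finv ` X))"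
    have "w = finsum W (\<lambda>X. f (u (finv ` X))) ((`) f ` \<U>)"
      using sum_image[of u] u v by blast
    also have "\<dots> = finsum W ?x ((`) f ` \<U>)"
      using u sub by (intro W.V.finsum_cong') (auto simp: finv_image intro!: f_closed, blast)
    finally show "?x \<in> (\<Pi>\<^sub>E X\<in>(`) f ` \<U>. X) \<and> w = finsum W ?x ((`) f ` \<U>)"
      using u by (auto simp: finv_image PiE_mem)
    fix x assume x: "x \<in> (\<Pi>\<^sub>E X\<in>(`) f ` \<U>. X) \<and> w = finsum W x ((`) f ` \<U>)"
    let ?u = "\<lambda>U\<in>\<U>. finv (x (f ` U))"
    have xU: "x (f ` U) \<in> f ` U" if "U \<in> \<U>" for U
      using x that by blast
    have uU: "?u U \<in> U" if "U \<in> \<U>" for U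
      using xU[OF that] finv_image[OF that] that by auto
    have fu: "f (?u U) = x (f ` U)" if "U \<in> \<U>" for U
      using xU[OF that] sub[OF that] that by (auto intro!: f_inv_into_f)
    have "f (finsum V ?u \<U>) = finsum W (\<lambda>X. f (?u (finv ` X))) ((`) f ` \<U>)"
      by (rule sum_image[OF uU])
    also have "\<dots> = finsum W x ((`) f ` \<U>)"
    proof (rule W.V.finsum_cong'[OF refl])
      show "x \<in> (`) f ` \<U> \<rightarrow> carrier W" using xU sub by fastforce
      fix X assume "X \<in> (`) f ` \<U>"
      then obtain U where "U \<in> \<U>" "X = f ` U" by auto
      then show "f (?u (finv ` X)) = x X" using fu[of U] finv_image[of U] by simp
    qed
    also have "\<dots> = f v" using x v by simp
    finally have "f (finsum V ?u \<U>) = f v" .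
    moreover have "finsum V ?u \<U> \<in> carrier V" by (rule V.finsum_closed[OF Pi[OF uU]])
    ultimately have "v = finsum V ?u \<U>" using v(1) by (metis finv_f)
    moreover have "?u \<in> (\<Pi>\<^sub>E U\<in>\<U>. U)" using uU by auto
    ultimately have "?u = u" using ex1[OF v(1)] u by blast
    show "x = ?x"
    proof
      fix X show "x X = ?x X"
      proof (cases "X \<in> (`) f ` \<U>")
        case True
        then obtain U where U: "U \<in> \<U>" "X = f ` U" by auto
        have "?x X = f (u U)" using U finv_image by simp
        also have "\<dots> = f (?u U)" using \<open>?u = u\<close> by simp
        finally show ?thesis using fu[OF U(1)] U(2) by simp
      qed (use x in auto)
    qed
  qed
qed

lemma isomorphic_image_iff:
  assumes "U \<subseteq> carrier V"
  shows "isomorphic_representations K G (W\<lparr>carrier := f ` U\<rparr>) \<sigma> X \<tau> \<longleftrightarrow>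
    isomorphic_representations K G (V\<lparr>carrier := U\<rparr>) \<rho> X \<tau>" (is "?L \<longleftrightarrow> ?R")
proof
  have bijU: "bij_betw f U (f ` U)"
    using assms inj_on_f by (simp add: bij_betw_def inj_on_subset)
  assume ?L
  then obtain h where h: "bij_betw h (f ` U) (carrier X)"
    "\<And>v v'. v \<in> f ` U \<Longrightarrow> v' \<in> f ` U \<Longrightarrow> h (v \<oplus>\<^bsub>W\<^esub> v') = h v \<oplus>\<^bsub>X\<^esub> h v'"
    "\<And>r v. r \<in> carrier K \<Longrightarrow> v \<in> f ` U \<Longrightarrow> h (r \<odot>\<^bsub>W\<^esub> v) = r \<odot>\<^bsub>X\<^esub> h v"
    "\<And>g v. g \<in> carrier G \<Longrightarrow> v \<in> f ` U \<Longrightarrow> h (\<sigma> g v) = \<tau> g (h v)"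
    by (auto simp: isomorphic_representations_def simp del: ball_simps)
  have "bij_betw (\<lambda>x. h (f x)) U (carrier X)"
    using bij_betw_trans[OF bijU h(1)] by (simp add: comp_def)
  then show ?R
    unfolding isomorphic_representations_def
    by (intro exI[of _ "\<lambda>x. h (f x)"])
      (use assms h in \<open>auto simp: subset_iff hom_add hom_smult equivariant\<close>)
next
  assume ?R
  then obtain h where h: "bij_betw h U (carrier X)"
    "\<And>v v'. v \<in> U \<Longrightarrow> v' \<in> U \<Longrightarrow> h (v \<oplus>\<^bsub>V\<^esub> v') = h v \<oplus>\<^bsub>X\<^esub> h v'"
    "\<And>r v. r \<in> carrier K \<Longrightarrow> v \<in> U \<Longrightarrow> h (r \<odot>\<^bsub>V\<^esub> v) = r \<odot>\<^bsub>X\<^esub> h v"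
    "\<And>g v. g \<in> carrier G \<Longrightarrow> v \<in> U \<Longrightarrow> h (\<rho> g v) = \<tau> g (h v)"
    by (auto simp: isomorphic_representations_def)
  have "bij_betw finv (f ` U) U"
    by (rule bij_betw_inv_into_subset[OF bij assms refl])
  then have "bij_betw (\<lambda>x. h (finv x)) (f ` U) (carrier X)"
    using bij_betw_trans[OF _ h(1), of finv "f ` U"] by (simp add: comp_def)
  moreover have "x \<in> carrier V" if "x \<in> U" for x
    using assms that by auto
  moreover have "x \<oplus>\<^bsub>V\<^esub> y \<in> carrier V" if "x \<in> U" "y \<in> U" for x y
    using assms that by auto
  ultimately show ?L
    unfolding isomorphic_representations_def
    by (intro exI[of _ "\<lambda>x. h (finv x)"])
      (auto simp: h act_closed simp flip: hom_add hom_smult equivariant)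
qed

text \<open>Decompositions of \<open>W\<close> are pulled back to \<open>V\<close> along the inverse isomorphism, where the
  number of summands of the given type is known.\<close>

lemma multiplicity_transport:
  assumes "occurs_with_multiplicity K G X \<tau> V \<rho> m"
  shows "occurs_with_multiplicity K G X \<tau> W \<sigma> m"
  unfolding occurs_with_multiplicity_def
proof (intro conjI allI impI)
  show "group_representation K X G \<tau>"
    using assms by (simp add: occurs_with_multiplicity_def)
  show "group_representation K W G \<sigma>" by (rule target_representation)
  show "\<exists>\<U>. irreducible_decomposition K G W \<sigma> \<U>"
    using assms decomposition_image by (auto simp: occurs_with_multiplicity_def)
  fix \<W> assume \<W>: "irreducible_decomposition K G W \<sigma> \<W>"
  interpret inv: representation_isomorphism K W G \<sigma> V \<rho> finv by (rule inverse_isomorphism)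
  let ?\<U> = "(`) finv ` \<W>"
  have "irreducible_decomposition K G V \<rho> ?\<U>" by (rule inv.decomposition_image[OF \<W>])
  then have m: "card {U \<in> ?\<U>. isomorphic_representations K G (V\<lparr>carrier := U\<rparr>) \<rho> X \<tau>} = m"
    using assms by (simp add: occurs_with_multiplicity_def)
  have sub: "U \<subseteq> carrier W" if "U \<in> \<W>" for U
    using \<W> that
    by (auto simp: irreducible_decomposition_def irreducible_subrepresentation_def
        W.subrepresentation_iff)
  have "f ` finv ` U = U" if "U \<in> \<W>" for U
    using sub[OF that] carrier_W by (metis image_inv_into_cancel)
  then have inj: "inj_on ((`) finv) \<W>" by (metis inj_onI)
  let ?T = "{U \<in> \<W>. isomorphic_representations K G (W\<lparr>carrier := U\<rparr>) \<sigma> X \<tau>}"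
  have "{U \<in> ?\<U>. isomorphic_representations K G (V\<lparr>carrier := U\<rparr>) \<rho> X \<tau>} = (`) finv ` ?T"
    using inv.isomorphic_image_iff[OF sub] by blast
  moreover have "inj_on ((`) finv) ?T" by (rule inj_on_subset[OF inj]) auto
  ultimately show "card ?T = m" using m by (simp add: card_image)
qed

end


section \<open>The invariant inner product\<close>

interpretation Q: vector_space "scale :: rat \<Rightarrow> ('s \<Rightarrow>\<^sub>0 rat) \<Rightarrow> ('s \<Rightarrow>\<^sub>0 rat)"
  by unfold_locales
    (simp_all add: scale_add, rule poly_mapping_eqI, simp add: lookup_add distrib_right)

text \<open>The inner product for which the basis vectors are orthonormal. Being preserved by every
  permutation of the basis, it replaces the averaging argument in Maschke's theorem, and it splits
  homology off the space of cycles.\<close>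

definition pairing :: "('s \<Rightarrow>\<^sub>0 rat) \<Rightarrow> ('s \<Rightarrow>\<^sub>0 rat) \<Rightarrow> rat" where
  "pairing c d = (\<Sum>s\<in>Poly_Mapping.keys c. Poly_Mapping.lookup c s * Poly_Mapping.lookup d s)"

lemma pairing_superset:
  assumes "finite A" "Poly_Mapping.keys c \<subseteq> A"
  shows "pairing c d = (\<Sum>s\<in>A. Poly_Mapping.lookup c s * Poly_Mapping.lookup d s)"
  unfolding pairing_def using assms by (intro sum.mono_neutral_left) (auto simp: in_keys_iff)

lemma pairing_commute: "pairing c d = pairing d c"
  using pairing_superset[of "Poly_Mapping.keys c \<union> Poly_Mapping.keys d" c d]
    pairing_superset[of "Poly_Mapping.keys c \<union> Poly_Mapping.keys d" d c]
  by (simp add: mult.commute)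

lemma pairing_add_right: "pairing c (d + e) = pairing c d + pairing c e"
  by (simp add: pairing_def lookup_add distrib_left sum.distrib)

lemma pairing_scale_right: "pairing c (scale r d) = r * pairing c d"
  by (simp add: pairing_def sum_distrib_left ac_simps)

lemma pairing_add_left: "pairing (c + d) e = pairing c e + pairing d e"
  by (metis pairing_add_right pairing_commute)

lemma pairing_scale_left: "pairing (scale r c) d = r * pairing c d"
  by (metis pairing_scale_right pairing_commute)

lemma pairing_zero_right [simp]: "pairing c 0 = 0"
  by (simp add: pairing_def)

lemma pairing_zero_left [simp]: "pairing 0 c = 0"
  by (simp add: pairing_def)

lemma pairing_diff_left: "pairing (c - d) e = pairing c e - pairing d e"
  by (metis add_diff_cancel_right' diff_add_cancel pairing_add_left)

lemma pairing_diff_right: "pairing e (c - d) = pairing e c - pairing e d"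
  by (metis pairing_diff_left pairing_commute)

lemma pairing_self_eq_0_iff [simp]: "pairing c c = 0 \<longleftrightarrow> c = 0"
proof
  assume "pairing c c = 0"
  then have "\<forall>s\<in>Poly_Mapping.keys c. Poly_Mapping.lookup c s * Poly_Mapping.lookup c s = 0"
    unfolding pairing_def by (subst (asm) sum_nonneg_eq_0_iff) auto
  then have "Poly_Mapping.lookup c s = 0" for s
    by (cases "s \<in> Poly_Mapping.keys c") (auto simp: in_keys_iff)
  then show "c = 0" by (intro poly_mapping_eqI) simp
qed simp

lemma pairing_single_right [simp]: "pairing c (Poly_Mapping.single s r) = Poly_Mapping.lookup c s * r"
  by (subst pairing_commute) (subst pairing_superset[of "{s}"], auto)

text \<open>Gram--Schmidt, one spanning vector at a time. The vectors are not normalised, as \<open>\<rat>\<close> lacks square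
  roots; positivity of \<open>pairing h h\<close> for \<open>h \<noteq> 0\<close> is all that the division
  requires.\<close>

lemma orthogonal_projection_span:
  assumes "finite F"
  shows "\<exists>b\<in>Q.span F. \<forall>x\<in>Q.span F. pairing (v - b) x = 0"
  using assms
proof (induction F arbitrary: v rule: finite_induct)
  case empty
  then show ?case by auto
next
  case (insert f F)
  obtain b0 where b0: "b0 \<in> Q.span F" "\<And>x. x \<in> Q.span F \<Longrightarrow> pairing (f - b0) x = 0"
    using insert.IH[of f] by blast
  obtain b where b: "b \<in> Q.span F" "\<And>x. x \<in> Q.span F \<Longrightarrow> pairing (v - b) x = 0"
    using insert.IH[of v] by blast
  define h where "h = f - b0"
  \<comment> \<open>If \<open>h = 0\<close>, the convention \<open>x / 0 = 0\<close> gives the right coefficient.\<close>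
  define r where "r = pairing (v - b) h / pairing h h"
  have mono: "x \<in> Q.span (insert f F)" if "x \<in> Q.span F" for x
    using that Q.span_mono[of F "insert f F"] by auto
  have "h \<in> Q.span (insert f F)"
    unfolding h_def using mono[OF b0(1)] by (intro Q.span_diff) (auto intro: Q.span_base)
  then have 1: "b + scale r h \<in> Q.span (insert f F)"
    using mono[OF b(1)] by (intro Q.span_add Q.span_scale)
  have "pairing (v - (b + scale r h)) x = 0" if x: "x \<in> Q.span (insert f F)" for x
  proof -
    obtain k where k: "x - scale k f \<in> Q.span F"
      using x by (auto simp: Q.span_insert)
    define y where "y = (x - scale k f) + scale k b0"
    have y: "y \<in> Q.span F"
      unfolding y_def using k b0(1) by (intro Q.span_add Q.span_scale)
    have "x = scale k h + y"
      by (simp add: y_def h_def Q.scale_right_diff_distrib)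
    moreover have "pairing (v - (b + scale r h)) y = 0"
      using b(2)[OF y] b0(2)[OF y]
      by (simp add: h_def pairing_diff_left pairing_add_left pairing_scale_left)
    moreover have "pairing (v - (b + scale r h)) h = 0"
      by (cases "h = 0")
        (simp_all add: r_def pairing_diff_left pairing_add_left pairing_scale_left)
    ultimately show ?thesis by (simp add: pairing_add_right pairing_scale_right)
  qed
  with 1 show ?case by blast
qed

text \<open>The space of all finitely supported functions may have infinite dimension, so finiteness of
  bases comes from the exchange lemma for a finite set \<open>F\<close> that spans the subspace in question.\<close>

lemma finite_basis:
  assumes "Q.subspace U" "U \<subseteq> Q.span F" "finite F"
  obtains B where "finite B" "Q.independent B" "B \<subseteq> U" "Q.span B = U" "card B = Q.dim U"
proof -
  obtain B where B: "B \<subseteq> U" "Q.independent B" "U \<subseteq> Q.span B" "card B = Q.dim U"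
    using Q.basis_exists by blast
  then have "finite B"
    using Q.independent_span_bound[of F B] assms by blast
  moreover have "Q.span B = U"
    using B assms(1) by (simp add: Q.span_minimal subset_antisym)
  ultimately show ?thesis using that B by blast
qed

lemma orthogonal_projection:
  assumes "Q.subspace U" "U \<subseteq> Q.span F" "finite F"
  obtains b where "b \<in> U" "\<And>x. x \<in> U \<Longrightarrow> pairing (v - b) x = 0"
proof -
  obtain B where "finite B" "Q.span B = U"
    by (rule finite_basis[OF assms])
  then show ?thesis using orthogonal_projection_span[of B v] that by blast
qed

lemma dim_less_of_psubset:
  assumes "Q.subspace U" "Q.subspace W" "U \<subset> W" "W \<subseteq> Q.span F" "finite F"
  shows "Q.dim U < Q.dim W"
proof -
  obtain B where B: "finite B" "Q.independent B" "B \<subseteq> U" "Q.span B = U" "card B = Q.dim U"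
    by (rule finite_basis[of U F]) (use assms in auto)
  obtain C where C: "finite C" "Q.span C = W" "card C = Q.dim W"
    by (rule finite_basis[of W F]) (use assms in auto)
  obtain x where x: "x \<in> W" "x \<notin> U" using assms(3) by blast
  then have "Q.independent (insert x B)" using B by (simp add: Q.independent_insert)
  moreover have "insert x B \<subseteq> Q.span C" using x B C assms(3) by auto
  ultimately have "card (insert x B) \<le> card C"
    using Q.independent_span_bound C(1) by blast
  moreover have "x \<notin> B" using x B by auto
  ultimately show ?thesis using B C by simp
qed


section \<open>Orthogonal representations and their invariants\<close>

definition subspace_module :: "('s \<Rightarrow>\<^sub>0 rat) set \<Rightarrow> (rat, 's \<Rightarrow>\<^sub>0 rat) module" where
  "subspace_module S = (free_module UNIV)\<lparr>carrier := S\<rparr>"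

lemma subspace_module_simps [simp]:
  "carrier (subspace_module S) = S"
  "\<zero>\<^bsub>subspace_module S\<^esub> = 0"
  "x \<oplus>\<^bsub>subspace_module S\<^esub> y = x + y"
  "r \<odot>\<^bsub>subspace_module S\<^esub> x = scale r x"
  "(subspace_module S)\<lparr>carrier := U\<rparr> = subspace_module U"
  by (simp_all add: subspace_module_def free_module_def)

lemma rat_field_simps [simp]:
  "carrier rat_field = UNIV" "\<zero>\<^bsub>rat_field\<^esub> = 0" "\<one>\<^bsub>rat_field\<^esub> = 1"
  "q \<oplus>\<^bsub>rat_field\<^esub> r = q + r" "q \<otimes>\<^bsub>rat_field\<^esub> r = q * r"
  by (simp_all add: rat_field_def)

lemma module_subspace_module:
  assumes "Q.subspace S"
  shows "module rat_field (subspace_module S)"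
proof (rule moduleI)
  show "cring rat_field" using field_rat_field by (simp add: field_def domain_def)
  show "abelian_group (subspace_module S)"
  proof (rule abelian_groupI)
    fix x assume "x \<in> carrier (subspace_module S)"
    then show "\<exists>y\<in>carrier (subspace_module S). y \<oplus>\<^bsub>subspace_module S\<^esub> x = \<zero>\<^bsub>subspace_module S\<^esub>"
      by (auto intro!: bexI[of _ "- x"] Q.subspace_neg[OF assms])
  qed (auto intro: Q.subspace_add[OF assms] Q.subspace_0[OF assms] simp: add_ac)
qed (auto intro: Q.subspace_scale[OF assms] simp: Q.scale_left_distrib Q.scale_right_distrib)

lemma trivial_representation:
  assumes "group G"
  shows "group_representation rat_field trivial_rep_space G trivial_action"
proof -
  interpret K: field rat_field by (rule field_rat_field)
  interpret G: group G by (rule assms)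
  have "module rat_field trivial_rep_space"
  proof (rule moduleI)
    show "abelian_group trivial_rep_space"
      by (rule abelian_groupI)
        (auto simp: trivial_rep_space_def intro: exI[of _ "- _"])
  qed (auto simp: trivial_rep_space_def algebra_simps K.is_cring)
  then interpret V: module rat_field trivial_rep_space .
  show ?thesis by unfold_locales (auto simp: trivial_action_def)
qed

text \<open>A representation on a subspace \<open>S\<close> by isometries. The finite spanning set \<open>F\<close> makes \<open>S\<close>
  finite-dimensional.\<close>

locale orthogonal_representation = G: group G
  for G :: "('g, 'z) monoid_scheme" (structure) +
  fixes S F :: "('s \<Rightarrow>\<^sub>0 rat) set"
    and \<rho> :: "'g \<Rightarrow> ('s \<Rightarrow>\<^sub>0 rat) \<Rightarrow> ('s \<Rightarrow>\<^sub>0 rat)"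
  assumes subspace_S: "Q.subspace S"
    and finite_F: "finite F"
    and S_span: "S \<subseteq> Q.span F"
    and act_closed: "\<lbrakk>g \<in> carrier G; v \<in> S\<rbrakk> \<Longrightarrow> \<rho> g v \<in> S"
    and act_add: "g \<in> carrier G \<Longrightarrow> \<rho> g (v + w) = \<rho> g v + \<rho> g w"
    and act_scale: "g \<in> carrier G \<Longrightarrow> \<rho> g (scale r v) = scale r (\<rho> g v)"
    and act_one: "\<rho> \<one> v = v"
    and act_mult: "\<lbrakk>g \<in> carrier G; h \<in> carrier G\<rbrakk> \<Longrightarrow> \<rho> (g \<otimes> h) v = \<rho> g (\<rho> h v)"
    and act_isometry: "g \<in> carrier G \<Longrightarrow> pairing (\<rho> g v) (\<rho> g w) = pairing v w"
begin

lemma representation: "group_representation rat_field (subspace_module S) G \<rho>"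
proof -
  interpret K: field rat_field by (rule field_rat_field)
  interpret V: module rat_field "subspace_module S" by (rule module_subspace_module[OF subspace_S])
  show ?thesis
    by unfold_locales (auto simp: act_closed act_add act_scale act_one act_mult)
qed

sublocale R: group_representation rat_field "subspace_module S" G \<rho>
  by (rule representation)

abbreviation subrep :: "('s \<Rightarrow>\<^sub>0 rat) set \<Rightarrow> bool" where
  "subrep \<equiv> subrepresentation rat_field G (subspace_module S) \<rho>"

abbreviation irreducible_subrep :: "('s \<Rightarrow>\<^sub>0 rat) set \<Rightarrow> bool" where
  "irreducible_subrep \<equiv> irreducible_subrepresentation rat_field G (subspace_module S) \<rho>"

lemma subrep_iff:
  "subrep U \<longleftrightarrow> Q.subspace U \<and> U \<subseteq> S \<and> (\<forall>g\<in>carrier G. \<forall>x\<in>U. \<rho> g x \<in> U)"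
  by (auto simp: R.subrepresentation_iff Q.subspace_def)

lemma act_zero: "g \<in> carrier G \<Longrightarrow> \<rho> g 0 = 0"
  using act_scale[of g 0 0] by simp

lemma act_sum: "g \<in> carrier G \<Longrightarrow> \<rho> g (sum u A) = (\<Sum>i\<in>A. \<rho> g (u i))"
  by (induction A rule: infinite_finite_induct) (auto simp: act_zero act_add)

lemma pairing_act_left:
  assumes "g \<in> carrier G"
  shows "pairing (\<rho> g v) w = pairing v (\<rho> (inv g) w)"
proof -
  have "\<rho> g (\<rho> (inv g) w) = w"
    using assms by (simp add: act_one flip: act_mult)
  then show ?thesis using act_isometry[OF assms, of v "\<rho> (inv g) w"] by simp
qed

definition complement :: "('s \<Rightarrow>\<^sub>0 rat) set \<Rightarrow> ('s \<Rightarrow>\<^sub>0 rat) set \<Rightarrow> ('s \<Rightarrow>\<^sub>0 rat) set" where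
  "complement W U = {x \<in> W. \<forall>y\<in>U. pairing x y = 0}"

text \<open>Invariance holds because the adjoint of an isometry \<open>\<rho> g\<close> is \<open>\<rho> (g\<inverse>)\<close>.\<close>

lemma subrep_complement:
  assumes "subrep W" "subrep U"
  shows "subrep (complement W U)"
proof -
  have W: "Q.subspace W" "W \<subseteq> S" "\<And>g x. g \<in> carrier G \<Longrightarrow> x \<in> W \<Longrightarrow> \<rho> g x \<in> W"
    and U: "\<And>g x. g \<in> carrier G \<Longrightarrow> x \<in> U \<Longrightarrow> \<rho> g x \<in> U"
    using assms by (auto simp: subrep_iff)
  have "Q.subspace (complement W U)"
  proof (rule Q.subspaceI)
    show "0 \<in> complement W U" using Q.subspace_0[OF W(1)] by (simp add: complement_def)
  qed (use Q.subspace_add[OF W(1)] Q.subspace_scale[OF W(1)] in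
      \<open>auto simp: complement_def pairing_add_left pairing_scale_left\<close>)
  then show ?thesis
    using W U by (auto simp: subrep_iff complement_def pairing_act_left)
qed

lemma complement_Int: "x \<in> U \<Longrightarrow> x \<in> complement W U \<Longrightarrow> x = 0"
  by (auto simp: complement_def)

lemma complement_sum:
  assumes "subrep W" "subrep U" "U \<subseteq> W" "w \<in> W"
  obtains u c where "u \<in> U" "c \<in> complement W U" "w = u + c"
proof -
  obtain b where b: "b \<in> U" "\<And>x. x \<in> U \<Longrightarrow> pairing (w - b) x = 0"
    by (rule orthogonal_projection[of U F w]) (use assms S_span finite_F in \<open>auto simp: subrep_iff\<close>)
  moreover have "w - b \<in> W" using assms b by (auto simp: subrep_iff intro: Q.subspace_diff)
  ultimately show ?thesis using that[of b "w - b"] by (auto simp: complement_def)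
qed

lemma subrep_dim_less:
  assumes "subrep U" "subrep W" "U \<subset> W"
  shows "Q.dim U < Q.dim W"
  by (rule dim_less_of_psubset[of _ _ F]) (use assms S_span finite_F in \<open>auto simp: subrep_iff\<close>)

text \<open>A reducible subrepresentation contains a nonzero one of smaller dimension, so the descent
  stops at an irreducible one.\<close>

lemma contains_irreducible:
  assumes "subrep W" "W \<noteq> {0}"
  obtains U where "irreducible_subrep U" "U \<subseteq> W"
  using assms
proof (induction "Q.dim W" arbitrary: W thesis rule: less_induct)
  case less
  show ?case
  proof (cases "irreducible_subrep W")
    case False
    then obtain U where U: "subrep U" "U \<subset> W" "U \<noteq> {0}"
      using less.prems by (auto simp: irreducible_subrepresentation_def)
    show ?thesis
    proof (rule less.hyps[OF subrep_dim_less[OF U(1) less.prems(2) U(2)] _ U(1) U(3)])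
      fix X assume "irreducible_subrep X" "X \<subseteq> U"
      then show thesis using less.prems(1)[of X] U(2) by auto
    qed
  qed (use less.prems in auto)
qed

text \<open>Inner direct sums, with uniqueness of the components stated as independence: zero has only
  the trivial decomposition. In this form the condition passes to orthogonal sums.\<close>

definition decomposes :: "('s \<Rightarrow>\<^sub>0 rat) set \<Rightarrow> ('s \<Rightarrow>\<^sub>0 rat) set set \<Rightarrow> bool" where
  "decomposes W \<U> \<longleftrightarrow>
     finite \<U> \<and> (\<forall>U\<in>\<U>. irreducible_subrep U \<and> U \<subseteq> W) \<and>
     (\<forall>v\<in>W. \<exists>u. (\<forall>U\<in>\<U>. u U \<in> U) \<and> v = sum u \<U>) \<and>
     (\<forall>u. (\<forall>U\<in>\<U>. u U \<in> U) \<and> sum u \<U> = 0 \<longrightarrow> (\<forall>U\<in>\<U>. u U = 0))"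

text \<open>Maschke's theorem: split off an irreducible subrepresentation and continue with its
  orthogonal complement.\<close>

lemma ex_decomposes:
  assumes "subrep W"
  shows "\<exists>\<U>. decomposes W \<U>"
  using assms
proof (induction "Q.dim W" arbitrary: W rule: less_induct)
  case less
  show ?case
  proof (cases "W = {0}")
    case True
    then have "decomposes W {}" by (auto simp: decomposes_def)
    then show ?thesis ..
  next
    case False
    obtain U where U: "irreducible_subrep U" "U \<subseteq> W"
      by (rule contains_irreducible[OF less.prems False])
    have subU: "subrep U" "U \<noteq> {0}" using U by (auto simp: irreducible_subrepresentation_def)
    let ?C = "complement W U"
    have subC: "subrep ?C" by (rule subrep_complement[OF less.prems subU(1)])
    obtain x where x: "x \<in> U" "x \<noteq> 0"
      using subU by (auto simp: subrep_iff Q.subspace_def)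
    then have "x \<in> W" "x \<notin> ?C" using U(2) complement_Int by auto
    then have "?C \<subset> W" by (auto simp: complement_def)
    from less.hyps[OF subrep_dim_less[OF subC less.prems this] subC]
    obtain \<U> where \<U>: "decomposes ?C \<U>" by blast
    have fin: "finite \<U>"
      and irr: "\<forall>X\<in>\<U>. irreducible_subrep X \<and> X \<subseteq> ?C"
      and sum: "\<forall>v\<in>?C. \<exists>u. (\<forall>X\<in>\<U>. u X \<in> X) \<and> v = sum u \<U>"
      and indep: "\<forall>u. (\<forall>X\<in>\<U>. u X \<in> X) \<and> sum u \<U> = 0 \<longrightarrow> (\<forall>X\<in>\<U>. u X = 0)"
      using \<U> unfolding decomposes_def by - (elim conjE, assumption)+
    have "U \<notin> \<U>"
    proof
      assume "U \<in> \<U>"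
      then have "U \<subseteq> ?C" using irr by simp
      then show False using x \<open>x \<notin> ?C\<close> by blast
    qed
    have "decomposes W (insert U \<U>)"
      unfolding decomposes_def
    proof (intro conjI)
      show "finite (insert U \<U>)" using fin by simp
      show "\<forall>X\<in>insert U \<U>. irreducible_subrep X \<and> X \<subseteq> W"
        using U irr \<open>?C \<subset> W\<close> by auto
      show "\<forall>v\<in>W. \<exists>u. (\<forall>X\<in>insert U \<U>. u X \<in> X) \<and> v = sum u (insert U \<U>)"
      proof
        fix v assume "v \<in> W"
        obtain y c where yc: "y \<in> U" "c \<in> ?C" "v = y + c"
          by (rule complement_sum[OF less.prems subU(1) U(2) \<open>v \<in> W\<close>])
        then obtain u where u: "\<forall>X\<in>\<U>. u X \<in> X" "c = sum u \<U>"
          using sum by blast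
        let ?u = "u(U := y)"
        have "sum ?u \<U> = sum u \<U>" using \<open>U \<notin> \<U>\<close> by (intro sum.cong) auto
        then have "v = sum ?u (insert U \<U>)" using u yc fin \<open>U \<notin> \<U>\<close> by simp
        moreover have "\<forall>X\<in>insert U \<U>. ?u X \<in> X" using u yc by auto
        ultimately show "\<exists>u. (\<forall>X\<in>insert U \<U>. u X \<in> X) \<and> v = sum u (insert U \<U>)" by blast
      qed
      show "\<forall>u. (\<forall>X\<in>insert U \<U>. u X \<in> X) \<and> sum u (insert U \<U>) = 0 \<longrightarrow>
          (\<forall>X\<in>insert U \<U>. u X = 0)"
      proof (intro allI impI ballI)
        fix u X assume u: "(\<forall>X\<in>insert U \<U>. u X \<in> X) \<and> sum u (insert U \<U>) = 0"
          and X: "X \<in> insert U \<U>"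
        have "sum u \<U> \<in> ?C"
          using irr u subC by (intro Q.subspace_sum) (auto simp: subrep_iff)
        moreover have eq: "u U = - sum u \<U>"
          using u fin \<open>U \<notin> \<U>\<close> by (simp add: add_eq_0_iff2)
        ultimately have "u U \<in> ?C" using subC by (simp add: subrep_iff Q.subspace_neg)
        then have "u U = 0" using u complement_Int by blast
        moreover have "sum u \<U> = 0" using eq \<open>u U = 0\<close> by simp
        then have "\<forall>X\<in>\<U>. u X = 0" using indep u by simp
        ultimately show "u X = 0" using X by auto
      qed
    qed
    then show ?thesis ..
  qed
qed

lemma finsum_eq_sum: "u \<in> A \<rightarrow> S \<Longrightarrow> finsum (subspace_module S) u A = sum u A"
proof (induction A rule: infinite_finite_induct)
  case (insert i A)
  then show ?case by (subst R.V.finsum_insert) (auto simp: Pi_iff)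
qed auto

lemma irreducible_decomposition_iff:
  "irreducible_decomposition rat_field G (subspace_module S) \<rho> \<U> \<longleftrightarrow> decomposes S \<U>"
proof -
  have conv: "(\<forall>v\<in>S. \<exists>!u. u \<in> (\<Pi>\<^sub>E U\<in>\<U>. U) \<and> v = finsum (subspace_module S) u \<U>) \<longleftrightarrow>
      (\<forall>v\<in>S. \<exists>u. (\<forall>U\<in>\<U>. u U \<in> U) \<and> v = sum u \<U>) \<and>
      (\<forall>u. (\<forall>U\<in>\<U>. u U \<in> U) \<and> sum u \<U> = 0 \<longrightarrow> (\<forall>U\<in>\<U>. u U = 0))"
    (is "?L \<longleftrightarrow> ?R1 \<and> ?R2") if irr: "\<And>U. U \<in> \<U> \<Longrightarrow> subrep U"
  proof -
    have sub: "U \<subseteq> S" if "U \<in> \<U>" for U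
      using irr[OF that] by (simp add: subrep_iff)
    have fs: "finsum (subspace_module S) u \<U> = sum u \<U>" if "\<forall>U\<in>\<U>. u U \<in> U" for u
      using sub that by (intro finsum_eq_sum) blast
    have restr: "sum (restrict u \<U>) \<U> = sum u \<U>" for u :: "('s \<Rightarrow>\<^sub>0 rat) set \<Rightarrow> ('s \<Rightarrow>\<^sub>0 rat)"
      by (intro sum.cong) auto
    show ?thesis
    proof (intro iffI conjI)
      assume L: ?L
      show ?R1
      proof
        fix v assume "v \<in> S"
        then obtain u where u: "u \<in> (\<Pi>\<^sub>E U\<in>\<U>. U)" "v = finsum (subspace_module S) u \<U>"
          using L by blast
        then have "\<forall>U\<in>\<U>. u U \<in> U" by auto
        with u(2) fs show "\<exists>u. (\<forall>U\<in>\<U>. u U \<in> U) \<and> v = sum u \<U>" by metis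
      qed
      show ?R2
      proof (intro allI impI ballI)
        fix u U assume u: "(\<forall>U\<in>\<U>. u U \<in> U) \<and> sum u \<U> = 0" and U: "U \<in> \<U>"
        have "0 \<in> S" using subspace_S by (simp add: Q.subspace_def)
        let ?z = "\<lambda>U\<in>\<U>. 0 :: 's \<Rightarrow>\<^sub>0 rat"
        have zero: "\<forall>U\<in>\<U>. ?z U \<in> U" using irr by (auto simp: subrep_iff Q.subspace_def)
        have u': "\<forall>U\<in>\<U>. restrict u \<U> U \<in> U" using u by auto
        have "?z \<in> (\<Pi>\<^sub>E U\<in>\<U>. U)" using zero by auto
        moreover have "0 = finsum (subspace_module S) ?z \<U>"
          unfolding fs[OF zero] by (rule sum.neutral[symmetric]) simp
        moreover have "restrict u \<U> \<in> (\<Pi>\<^sub>E U\<in>\<U>. U)" using u by auto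
        moreover have "0 = finsum (subspace_module S) (restrict u \<U>) \<U>"
          unfolding fs[OF u'] restr using u by simp
        ultimately have "restrict u \<U> = ?z" using L \<open>0 \<in> S\<close> by blast
        then have "restrict u \<U> U = ?z U" by simp
        then show "u U = 0" using U by simp
      qed
    next
      assume R: "?R1 \<and> ?R2"
      show ?L
      proof
        fix v assume "v \<in> S"
        then obtain u where u: "\<forall>U\<in>\<U>. u U \<in> U" "v = sum u \<U>" using R by blast
        show "\<exists>!u. u \<in> (\<Pi>\<^sub>E U\<in>\<U>. U) \<and> v = finsum (subspace_module S) u \<U>"
        proof (rule ex1I)
          have u': "\<forall>U\<in>\<U>. restrict u \<U> U \<in> U" using u by auto
          show "restrict u \<U> \<in> (\<Pi>\<^sub>E U\<in>\<U>. U) \<and>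
              v = finsum (subspace_module S) (restrict u \<U>) \<U>"
            unfolding fs[OF u'] restr using u by auto
          fix w assume w: "w \<in> (\<Pi>\<^sub>E U\<in>\<U>. U) \<and> v = finsum (subspace_module S) w \<U>"
          then have w': "\<forall>U\<in>\<U>. w U \<in> U" by auto
          have "\<forall>U\<in>\<U>. w U - u U \<in> U"
            using irr w' u by (auto simp: subrep_iff intro: Q.subspace_diff)
          moreover have "(\<Sum>U\<in>\<U>. w U - u U) = 0"
            using w u fs[OF w'] by (simp add: sum_subtractf)
          ultimately have "\<forall>U\<in>\<U>. w U - u U = 0"
            using R[THEN conjunct2, rule_format, of "\<lambda>U. w U - u U"] by blast
          then show "w = restrict u \<U>"
            using w by (intro extensionalityI[of _ \<U>]) (auto simp: PiE_iff)
        qed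
      qed
    qed
  qed
  show ?thesis
  proof (cases "\<forall>U\<in>\<U>. irreducible_subrep U")
    case True
    then have sub: "subrep U" if "U \<in> \<U>" for U
      using that by (simp add: irreducible_subrepresentation_def)
    then have 1: "(\<forall>U\<in>\<U>. irreducible_subrep U \<and> U \<subseteq> S) = True"
      using True by (simp add: subrep_iff)
    show ?thesis
      unfolding irreducible_decomposition_def decomposes_def subspace_module_simps
        conv[OF sub, simplified] 1 eqTrueI[OF True] ..
  qed (auto simp: irreducible_decomposition_def decomposes_def)
qed

definition invariants :: "('s \<Rightarrow>\<^sub>0 rat) set" where
  "invariants = {v \<in> S. \<forall>g\<in>carrier G. \<rho> g v = v}"

text \<open>An invariant vector spans a one-dimensional subrepresentation, which exhausts an irreducible
  one.\<close>

lemma irreducible_eq_line: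
  assumes "irreducible_subrep U" "e \<in> U" "e \<noteq> 0" "\<And>g. g \<in> carrier G \<Longrightarrow> \<rho> g e = e"
  shows "U = range (\<lambda>r. scale r e)"
proof -
  have U: "subrep U" and min: "\<And>U'. subrep U' \<Longrightarrow> U' \<subseteq> U \<Longrightarrow> U' = {0} \<or> U' = U"
    using assms(1) unfolding irreducible_subrepresentation_def subspace_module_simps by blast+
  have sub: "range (\<lambda>r. scale r e) \<subseteq> U"
    using U assms(2) by (auto simp: subrep_iff Q.subspace_scale)
  have "Q.subspace (range (\<lambda>r. scale r e))"
    using Q.subspace_span[of "{e}"] by (simp add: Q.span_singleton)
  then have "subrep (range (\<lambda>r. scale r e))"
    using sub U assms(4) by (auto simp: subrep_iff act_scale)
  moreover have "e \<in> range (\<lambda>r. scale r e)" by (rule range_eqI[of _ _ 1]) simp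
  ultimately show ?thesis using min[OF _ sub] assms(3) by blast
qed

text \<open>The preimage of \<open>1\<close> under an isomorphism to the trivial representation is an invariant
  vector. Conversely, on the line through an invariant vector \<open>e\<close>, the coordinate with respect to
  \<open>e\<close> is an isomorphism; it is read off at any basis element where \<open>e\<close> does not vanish.\<close>

lemma isomorphic_to_trivial_iff:
  assumes irr: "irreducible_subrep U"
  shows "isomorphic_representations rat_field G (subspace_module U) \<rho>
      trivial_rep_space trivial_action \<longleftrightarrow>
    (\<exists>e\<in>U. e \<noteq> 0 \<and> (\<forall>g\<in>carrier G. \<rho> g e = e))" (is "?L \<longleftrightarrow> ?R")
proof
  have U: "subrep U" using irr by (simp add: irreducible_subrepresentation_def)
  assume ?L
  then obtain f where f: "bij_betw f U (UNIV :: rat set)"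
    "\<And>v v'. v \<in> U \<Longrightarrow> v' \<in> U \<Longrightarrow> f (v + v') = f v + f v'"
    "\<And>g v. g \<in> carrier G \<Longrightarrow> v \<in> U \<Longrightarrow> f (\<rho> g v) = f v"
    by (auto simp: isomorphic_representations_def trivial_rep_space_def trivial_action_def)
  obtain e where e: "e \<in> U" "f e = 1"
    using f(1) by (metis UNIV_I bij_betw_apply bij_betw_inv_into bij_betw_inv_into_right)
  have "0 \<in> U" using U by (simp add: subrep_iff Q.subspace_def)
  then have "f 0 = 0" using f(2)[of 0 0] by simp
  then have "e \<noteq> 0" using e by auto
  moreover have "\<rho> g e = e" if "g \<in> carrier G" for g
    using inj_onD[OF bij_betw_imp_inj_on[OF f(1)] f(3)[OF that e(1)]] U e that
    by (auto simp: subrep_iff)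
  ultimately show ?R using e by blast
next
  assume ?R
  then obtain e where e: "e \<in> U" "e \<noteq> 0" "\<And>g. g \<in> carrier G \<Longrightarrow> \<rho> g e = e" by blast
  then have U: "U = range (\<lambda>r. scale r e)" by (rule irreducible_eq_line[OF irr])
  obtain s where s: "Poly_Mapping.lookup e s \<noteq> 0"
    using e(2) by (metis lookup_zero poly_mapping_eqI)
  let ?f = "\<lambda>x. Poly_Mapping.lookup x s / Poly_Mapping.lookup e s"
  have "bij_betw ?f U UNIV"
    by (rule bij_betw_byWitness[where f' = "\<lambda>r. scale r e"]) (use s in \<open>auto simp: U\<close>)
  then show ?L
    unfolding isomorphic_representations_def
    by (intro exI[of _ ?f])
      (auto simp: trivial_rep_space_def trivial_action_def lookup_add add_divide_distrib U
        act_scale e(3))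
qed

text \<open>Choose an invariant vector in each trivial summand. These vectors are independent because
  the sum is direct. They span the invariants: the components of an invariant vector are invariant
  by uniqueness of the decomposition, and a nonzero invariant component forces its summand to be
  trivial.\<close>

theorem trivial_multiplicity:
  "occurs_with_multiplicity rat_field G trivial_rep_space trivial_action
     (subspace_module S) \<rho> (Q.dim invariants)"
  unfolding occurs_with_multiplicity_def
proof (intro conjI allI impI)
  show "group_representation rat_field trivial_rep_space G trivial_action"
    by (rule trivial_representation) (rule G.is_group)
  show "group_representation rat_field (subspace_module S) G \<rho>" by (rule representation)
  have "subrep S" using subspace_S by (simp add: subrep_iff act_closed)
  then show "\<exists>\<U>. irreducible_decomposition rat_field G (subspace_module S) \<rho> \<U>"
    by (simp add: irreducible_decomposition_iff ex_decomposes)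
  fix \<U> assume "irreducible_decomposition rat_field G (subspace_module S) \<rho> \<U>"
  then have dec: "decomposes S \<U>" by (simp add: irreducible_decomposition_iff)
  then have fin: "finite \<U>" and irr: "\<And>U. U \<in> \<U> \<Longrightarrow> irreducible_subrep U"
    and ex: "\<And>v. v \<in> S \<Longrightarrow> \<exists>u. (\<forall>U\<in>\<U>. u U \<in> U) \<and> v = sum u \<U>"
    and indep: "\<And>u U. (\<And>U. U \<in> \<U> \<Longrightarrow> u U \<in> U) \<Longrightarrow> sum u \<U> = 0 \<Longrightarrow> U \<in> \<U> \<Longrightarrow> u U = 0"
    by (auto simp: decomposes_def)
  have sub: "subrep U" if "U \<in> \<U>" for U
    using irr[OF that] by (simp add: irreducible_subrepresentation_def)
  have zero_in: "0 \<in> U" if "U \<in> \<U>" for U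
    using sub[OF that] by (simp add: subrep_iff Q.subspace_def)
  define T where "T = {U \<in> \<U>. \<exists>e\<in>U. e \<noteq> 0 \<and> (\<forall>g\<in>carrier G. \<rho> g e = e)}"
  have "{U \<in> \<U>. isomorphic_representations rat_field G ((subspace_module S)\<lparr>carrier := U\<rparr>) \<rho>
      trivial_rep_space trivial_action} = T"
    using irr by (auto simp: T_def isomorphic_to_trivial_iff)
  moreover have "card T = Q.dim invariants"
  proof -
    have "\<forall>U\<in>T. \<exists>e\<in>U. e \<noteq> 0 \<and> (\<forall>g\<in>carrier G. \<rho> g e = e)" by (simp add: T_def)
    then obtain e where e: "\<And>U. U \<in> T \<Longrightarrow> e U \<in> U" "\<And>U. U \<in> T \<Longrightarrow> e U \<noteq> 0"
      "\<And>U g. U \<in> T \<Longrightarrow> g \<in> carrier G \<Longrightarrow> \<rho> g (e U) = e U"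
      by metis
    have T: "T \<subseteq> \<U>" by (auto simp: T_def)
    have line: "U = range (\<lambda>r. scale r (e U))" if "U \<in> T" for U
      by (rule irreducible_eq_line) (use that T irr e in auto)
    have inj: "inj_on e T" by (metis line inj_onI)
    have "Q.dim invariants = card (e ` T)"
    proof (rule Q.dim_unique[OF _ _ _ refl])
      show "e ` T \<subseteq> invariants"
        using e sub T by (force simp: invariants_def subrep_iff)
      show "Q.independent (e ` T)"
      proof (rule Q.independent_if_scalars_zero)
        show "finite (e ` T)" using T fin by (auto intro: finite_subset)
        fix r x assume 0: "(\<Sum>x\<in>e ` T. scale (r x) x) = 0" and x: "x \<in> e ` T"
        let ?u = "\<lambda>U. if U \<in> T then scale (r (e U)) (e U) else 0"
        have "sum ?u \<U> = (\<Sum>U\<in>T. scale (r (e U)) (e U))"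
          using fin T by (intro sum.mono_neutral_cong_right) auto
        also have "\<dots> = 0" using 0 by (simp add: sum.reindex[OF inj])
        finally have "sum ?u \<U> = 0" .
        moreover have "?u U \<in> U" if "U \<in> \<U>" for U
          using e(1) sub[OF that] zero_in[OF that] by (auto simp: subrep_iff Q.subspace_scale)
        ultimately have "?u U = 0" if "U \<in> \<U>" for U
          using indep[of ?u] that by blast
        moreover obtain U where "U \<in> T" "x = e U" using x by blast
        ultimately show "r x = 0" using T e(2) by (metis Q.scale_eq_0_iff subsetD)
      qed
      show "invariants \<subseteq> Q.span (e ` T)"
      proof
        fix v assume v: "v \<in> invariants"
        then have "v \<in> S" by (simp add: invariants_def)
        then obtain u where u: "\<And>U. U \<in> \<U> \<Longrightarrow> u U \<in> U" "v = sum u \<U>"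
          using ex by blast
        have inv: "\<rho> g (u U) = u U" if g: "g \<in> carrier G" and U: "U \<in> \<U>" for g U
        proof -
          have "\<rho> g (u U) - u U \<in> U" if "U \<in> \<U>" for U
            using sub[OF that] u(1)[OF that] g by (auto simp: subrep_iff intro: Q.subspace_diff)
          moreover have "(\<Sum>U\<in>\<U>. \<rho> g (u U) - u U) = 0"
            using v g u(2) by (simp add: sum_subtractf invariants_def flip: act_sum)
          ultimately have "\<rho> g (u U) - u U = 0"
            using indep[of "\<lambda>U. \<rho> g (u U) - u U"] U by blast
          then show ?thesis by simp
        qed
        have "u U \<in> Q.span (e ` T)" if U: "U \<in> \<U>" for U
        proof (cases "u U = 0")
          case False
          then have "U \<in> T" using U u(1) inv by (auto simp: T_def)
          then obtain r where "u U = scale r (e U)" using u(1)[OF U] line by blast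
          then show ?thesis using \<open>U \<in> T\<close> by (auto intro: Q.span_scale Q.span_base)
        qed (simp add: Q.span_zero)
        then show "v \<in> Q.span (e ` T)" using u(2) by (auto intro: Q.span_sum)
      qed
    qed
    then show ?thesis by (simp add: card_image[OF inj])
  qed
  ultimately show "card {U \<in> \<U>. isomorphic_representations rat_field G
      ((subspace_module S)\<lparr>carrier := U\<rparr>) \<rho> trivial_rep_space trivial_action} = Q.dim invariants"
    by simp
qed

end


section \<open>Chains, relabelling and the boundary in width two\<close>

lemma chain_eq_sum_single:
  "c = (\<Sum>s\<in>Poly_Mapping.keys c. scale (Poly_Mapping.lookup c s) (Poly_Mapping.single s 1))"
  by (rule poly_mapping_eqI)
    (simp add: lookup_sum lookup_single when_def in_keys_iff if_distrib[of "(*) _"] cong: if_cong)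

lemma subspace_supported: "Q.subspace {c. Poly_Mapping.keys c \<subseteq> A}"
  unfolding Q.subspace_def by (auto simp: in_keys_iff lookup_add subset_iff) (metis add_0)

text \<open>Linear statements about chains thereby reduce to single symbols, by induction over the
  span.\<close>

lemma supported_eq_span:
  "{c. Poly_Mapping.keys c \<subseteq> A} = Q.span ((\<lambda>s. Poly_Mapping.single s 1) ` A)"
proof
  show "{c. Poly_Mapping.keys c \<subseteq> A} \<subseteq> Q.span ((\<lambda>s. Poly_Mapping.single s 1) ` A)"
  proof
    fix c :: "'a \<Rightarrow>\<^sub>0 rat" assume "c \<in> {c. Poly_Mapping.keys c \<subseteq> A}"
    then have "(\<Sum>s\<in>Poly_Mapping.keys c. scale (Poly_Mapping.lookup c s) (Poly_Mapping.single s 1))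
        \<in> Q.span ((\<lambda>s. Poly_Mapping.single s 1) ` A)"
      by (intro Q.span_sum Q.span_scale Q.span_base) auto
    then show "c \<in> Q.span ((\<lambda>s. Poly_Mapping.single s 1) ` A)"
      by (simp flip: chain_eq_sum_single)
  qed
  show "Q.span ((\<lambda>s. Poly_Mapping.single s 1) ` A) \<subseteq> {c. Poly_Mapping.keys c \<subseteq> A}"
    by (rule Q.span_minimal[OF _ subspace_supported]) (auto split: if_splits)
qed

lemma carrier_chains: "carrier (chains n w k) = {c. Poly_Mapping.keys c \<subseteq> cells n w k}"
  by (simp add: chains_def free_module_def)

lemma carrier_chains_eq_span:
  "carrier (chains n w k) = Q.span ((\<lambda>s. Poly_Mapping.single s 1) ` cells n w k)"
  by (simp only: carrier_chains supported_eq_span)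

lemma finite_cells: "finite (cells n w k)"
proof (rule finite_subset)
  let ?B = "{b. set b \<subseteq> {1..n} \<and> length b \<le> w}"
  show "cells n w k \<subseteq> {s. set s \<subseteq> ?B \<and> length s \<le> n}"
    by (auto simp: cells_def symbols_def)
  show "finite {s. set s \<subseteq> ?B \<and> length s \<le> n}"
    by (simp add: finite_lists_length_le)
qed

lemma boundary_add: "boundary (c + d) = boundary c + boundary d"
  and boundary_diff: "boundary (c - d) = boundary c - boundary d"
  and boundary_scale: "boundary (scale r c) = scale r (boundary c)"
  and boundary_single: "boundary (Poly_Mapping.single s r) = scale r (symbol_boundary s)"
  and boundary_0 [simp]: "boundary 0 = 0"
  by (simp_all add: boundary_def linear_extension_add linear_extension_diff
      linear_extension_scale linear_extension_def[of _ 0])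

lemma relabel_add: "relabel p (c + d) = relabel p c + relabel p d"
  and relabel_diff: "relabel p (c - d) = relabel p c - relabel p d"
  and relabel_scale: "relabel p (scale r c) = scale r (relabel p c)"
  and relabel_0 [simp]: "relabel p 0 = 0"
  by (simp_all add: relabel_def linear_extension_add linear_extension_diff
      linear_extension_scale linear_extension_def[of _ 0])

lemma relabel_single [simp]:
  "relabel p (Poly_Mapping.single s r) = Poly_Mapping.single (map (map p) s) r"
  by (rule poly_mapping_eqI) (simp add: relabel_def lookup_single when_def)

lemma relabel_id [simp]: "relabel id c = c"
  by (induction c rule: chain_induct) (simp_all add: relabel_add)

lemma relabel_comp: "relabel (p \<circ> q) c = relabel p (relabel q c)"
  by (induction c rule: chain_induct) (simp_all add: relabel_add comp_def)

lemma relabel_bar: "relabel p (bar c d) = bar (relabel p c) (relabel p d)"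
proof (induction c rule: chain_induct)
  case (single s r)
  show ?case
    by (induction d rule: chain_induct) (simp_all add: bar_add_right relabel_add)
qed (simp_all add: bar_add_left relabel_add)

lemma pairing_relabel:
  assumes "inj p"
  shows "pairing (relabel p c) (relabel p d) = pairing c d"
proof (induction d rule: chain_induct)
  case (single t r)
  show ?case
  proof (induction c rule: chain_induct)
    case (single s q)
    have "inj (map (map p))" using assms by simp
    then have "map (map p) s = map (map p) t \<longleftrightarrow> s = t" by (simp add: inj_eq)
    then show ?case by (simp add: lookup_single when_def)
  qed (simp_all add: relabel_add pairing_add_left del: pairing_single_right)
qed (simp_all add: relabel_add pairing_add_right)

lemma block_boundary_1: "block_boundary [a] = 0"
proof -
  have "block_splits [a] = {}"
    by (auto simp: block_splits_def dest: length_shuffles) (metis One_nat_def add_is_1 length_0_conv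
        length_Cons length_shuffles list.size(3))
  then show ?thesis by (simp add: block_boundary_def)
qed

lemma block_boundary_2:
  assumes "a \<noteq> b"
  shows "block_boundary [a, b]
    = Poly_Mapping.single [[a], [b]] 1 - Poly_Mapping.single [[b], [a]] 1"
proof -
  have splits: "block_splits [a, b] = {([a], [b]), ([b], [a])}"
  proof
    show "block_splits [a, b] \<subseteq> {([a], [b]), ([b], [a])}"
    proof
      fix x assume "x \<in> block_splits [a, b]"
      then obtain \<alpha> \<beta> where x: "x = (\<alpha>, \<beta>)" "\<alpha> \<noteq> []" "\<beta> \<noteq> []" "[a, b] \<in> shuffles \<alpha> \<beta>"
        by (auto simp: block_splits_def)
      moreover have "length \<alpha> + length \<beta> = 2" using length_shuffles[OF x(4)] by simp
      moreover have "length \<alpha> > 0" "length \<beta> > 0" using x by auto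
      ultimately have "length \<alpha> = 1" "length \<beta> = 1" by linarith+
      then obtain c d where "\<alpha> = [c]" "\<beta> = [d]" by (auto simp: length_Suc_conv)
      with x show "x \<in> {([a], [b]), ([b], [a])}" by auto
    qed
  qed (auto simp: block_splits_def)
  have "word_sign [a, b] [a, b] = 1"
  proof -
    have "(THE p. p permutes set [a, b] \<and> map p [a, b] = [a, b]) = id"
    proof (rule the_equality)
      fix p assume p: "p permutes set [a, b] \<and> map p [a, b] = [a, b]"
      show "p = id"
      proof
        fix x show "p x = id x"
          using p by (cases "x \<in> {a, b}") (auto simp: permutes_def)
      qed
    qed (simp add: permutes_id)
    then show ?thesis unfolding word_sign_def by (metis sign_id)
  qed
  moreover have "word_sign [a, b] [b, a] = -1"
  proof -
    have "(THE p. p permutes set [a, b] \<and> map p [a, b] = [b, a]) = Transposition.transpose a b"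
    proof (rule the_equality)
      show "Transposition.transpose a b permutes set [a, b] \<and>
          map (Transposition.transpose a b) [a, b] = [b, a]"
        by (simp add: permutes_swap_id)
      fix p assume p: "p permutes set [a, b] \<and> map p [a, b] = [b, a]"
      show "p = Transposition.transpose a b"
      proof
        fix x show "p x = Transposition.transpose a b x"
          using p by (cases "x \<in> {a, b}") (auto simp: permutes_def)
      qed
    qed
    then show ?thesis unfolding word_sign_def using assms by (metis sign_swap_id)
  qed
  ultimately show ?thesis
    using assms by (simp add: block_boundary_def splits single_uminus)
qed

text \<open>The conditions on a symbol under which the boundary formulas of width two apply. Unlike
  membership in \<open>cells n 2 k\<close>, they are inherited by the symbol without its first block, which
  permits induction.\<close>

definition narrow :: "symbol \<Rightarrow> bool" where
  "narrow s \<longleftrightarrow> (\<forall>b\<in>set s. b \<noteq> [] \<and> distinct b \<and> length b \<le> 2)"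

lemma narrow_cases [consumes 1, case_names Nil one two]:
  assumes "narrow s"
  obtains "s = []"
  | a t where "s = [a] # t" "narrow t"
  | a b t where "s = [a, b] # t" "a \<noteq> b" "narrow t"
proof (cases s)
  case (Cons g t)
  with assms have g: "g \<noteq> []" "distinct g" "length g \<le> 2" and t: "narrow t"
    by (auto simp: narrow_def)
  then consider a where "g = [a]" | a b where "g = [a, b]" "a \<noteq> b"
    by (cases g; cases "tl g") auto
  then show ?thesis using Cons t that by cases auto
qed (use that in auto)

lemma narrow_induct [consumes 1, case_names Nil one two]:
  assumes "narrow s"
    and "P []"
    and "\<And>a s. narrow s \<Longrightarrow> P s \<Longrightarrow> P ([a] # s)"
    and "\<And>a b s. a \<noteq> b \<Longrightarrow> narrow s \<Longrightarrow> P s \<Longrightarrow> P ([a, b] # s)"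
  shows "P s"
  using assms(1)
proof (induction s)
  case (Cons g s)
  from Cons.prems show ?case
    by (cases rule: narrow_cases) (use Cons.IH assms in auto)
qed (use assms in auto)

lemma narrow_cells: "s \<in> cells n 2 k \<Longrightarrow> narrow s"
  unfolding cells_def symbols_def narrow_def by (auto simp: distinct_concat_iff)

lemma symbol_boundary_one:
  "symbol_boundary ([a] # s) = - bar (Poly_Mapping.single [[a]] 1) (symbol_boundary s)"
  by (simp add: block_boundary_1)

lemma symbol_boundary_two:
  assumes "a \<noteq> b"
  shows "symbol_boundary ([a, b] # s)
    = Poly_Mapping.single ([a] # [b] # s) 1 - Poly_Mapping.single ([b] # [a] # s) 1
      - bar (Poly_Mapping.single [[a, b]] 1) (symbol_boundary s)"
  by (simp add: block_boundary_2[OF assms] bar_diff_left)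

lemma boundary_bar_block:
  "boundary (bar (Poly_Mapping.single [g] 1) c)
    = bar (block_boundary g) c - bar (Poly_Mapping.single [g] 1) (boundary c)"
proof (induction c rule: chain_induct)
  case (single s r)
  have r: "Poly_Mapping.single s r = scale r (Poly_Mapping.single s 1)" for s :: symbol
    by (rule poly_mapping_eqI) (simp add: lookup_single when_def)
  show ?case
    unfolding r[of s] bar_scale_right boundary_scale
    by (simp add: boundary_single bar_diff_left Q.scale_right_diff_distrib)
qed (simp_all add: bar_add_right boundary_add)

text \<open>For a first block \<open>[a, b]\<close> the terms \<open>[a]|[b]|\<partial>s - [b]|[a]|\<partial>s\<close> arise twice with opposite signs:
  as the boundary of the two faces that split the first block, and as the first-block part of the
  boundary of \<open>[a, b]|\<partial>s\<close>.\<close>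

lemma boundary_symbol_boundary:
  assumes "narrow s"
  shows "boundary (symbol_boundary s) = 0"
  using assms
proof (induction rule: narrow_induct)
  case (one a s)
  have "boundary (symbol_boundary ([a] # s))
      = - boundary (bar (Poly_Mapping.single [[a]] 1) (symbol_boundary s))"
    using boundary_diff[of 0] by (simp only: symbol_boundary_one) simp
  then show ?case by (simp only: boundary_bar_block one.IH block_boundary_1) simp
next
  case (two a b s)
  have ab: "symbol_boundary ([x] # [y] # s)
      = bar (Poly_Mapping.single [[x], [y]] 1) (symbol_boundary s)" for x y
  proof -
    have "symbol_boundary ([x] # [y] # s)
        = bar (Poly_Mapping.single [[x]] 1) (bar (Poly_Mapping.single [[y]] 1) (symbol_boundary s))"
      using bar_diff_left[of 0] bar_add_right
      by (simp only: symbol_boundary_one) (metis add.inverse_inverse bar_scale_right scale_minus_one)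
    then show ?thesis by (simp flip: bar_assoc)
  qed
  show ?case
    by (simp only: symbol_boundary_two[OF two(1)] boundary_diff boundary_single boundary_bar_block
        two.IH block_boundary_2[OF two(1)] ab scale_one bar_diff_left) simp
qed simp

text \<open>The boundary of a symbol in width two is a combination of these differences: splitting the
  block \<open>ab\<close> yields \<open>a|b\<close> and \<open>b|a\<close> with opposite signs, and the two faces differ by a
  relabelling.\<close>

definition split_pairs :: "symbol \<Rightarrow> chain set" where
  "split_pairs s = {Poly_Mapping.single (u @ [a] # [b] # v) 1 - Poly_Mapping.single (u @ [b] # [a] # v) 1
     | u a b v. s = u @ [a, b] # v}"

lemma split_pairsI:
  "Poly_Mapping.single (u @ [a] # [b] # v) 1 - Poly_Mapping.single (u @ [b] # [a] # v) 1
    \<in> split_pairs (u @ [a, b] # v)"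
  unfolding split_pairs_def by blast

lemma bar_split_pairs:
  assumes "c \<in> Q.span (split_pairs s)"
  shows "bar (Poly_Mapping.single [g] 1) c \<in> Q.span (split_pairs (g # s))"
  using assms
proof (rule Q.span_induct)
  show "Q.subspace {c. bar (Poly_Mapping.single [g] 1) c \<in> Q.span (split_pairs (g # s))}"
    by (auto simp: Q.subspace_def bar_add_right bar_scale_right
        intro: Q.span_zero Q.span_add Q.span_scale)
  fix c assume "c \<in> split_pairs s"
  then obtain u a b v where s: "s = u @ [a, b] # v"
    and c: "c = Poly_Mapping.single (u @ [a] # [b] # v) 1 - Poly_Mapping.single (u @ [b] # [a] # v) 1"
    by (auto simp: split_pairs_def)
  have "bar (Poly_Mapping.single [g] 1) c
      + bar (Poly_Mapping.single [g] 1) (Poly_Mapping.single (u @ [b] # [a] # v) 1)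
      = bar (Poly_Mapping.single [g] 1) (Poly_Mapping.single (u @ [a] # [b] # v) 1)"
    by (simp only: bar_add_right[symmetric] c diff_add_cancel)
  then have "bar (Poly_Mapping.single [g] 1) c
      = Poly_Mapping.single ((g # u) @ [a] # [b] # v) 1 - Poly_Mapping.single ((g # u) @ [b] # [a] # v) 1"
    by (simp add: eq_diff_eq)
  then have "bar (Poly_Mapping.single [g] 1) c \<in> split_pairs (g # s)"
    using split_pairsI[of "g # u" a b v] by (simp add: s)
  then show "bar (Poly_Mapping.single [g] 1) c \<in> Q.span (split_pairs (g # s))"
    by (rule Q.span_base)
qed

lemma symbol_boundary_in_split_pairs:
  assumes "narrow s"
  shows "symbol_boundary s \<in> Q.span (split_pairs s)"
  using assms
proof (induction rule: narrow_induct)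
  case Nil
  then show ?case by (simp add: Q.span_zero)
next
  case (one a s)
  show ?case
    unfolding symbol_boundary_one by (rule Q.span_neg[OF bar_split_pairs[OF one.IH]])
next
  case (two a b s)
  have "Poly_Mapping.single ([a] # [b] # s) 1 - Poly_Mapping.single ([b] # [a] # s) 1
      \<in> split_pairs ([a, b] # s)"
    using split_pairsI[of "[]" a b s] by simp
  then show ?case
    unfolding symbol_boundary_two[OF two(1)]
    by (intro Q.span_diff[OF _ bar_split_pairs[OF two.IH]] Q.span_base)
qed

lemma relabel_symbol_boundary:
  assumes "narrow s" "inj p"
  shows "symbol_boundary (map (map p) s) = relabel p (symbol_boundary s)"
  using assms(1)
proof (induction rule: narrow_induct)
  case (one a s)
  have "relabel p (- c) = - relabel p c" for c
    using relabel_diff[of p 0 c] by simp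
  then show ?case
    by (simp only: list.map symbol_boundary_one one.IH relabel_bar relabel_single)
next
  case (two a b s)
  then have "p a \<noteq> p b" using assms(2) by (simp add: inj_eq)
  then show ?case
    by (simp only: list.map symbol_boundary_two[OF two(1)] symbol_boundary_two[of "p a" "p b"]
        two.IH relabel_bar relabel_single relabel_diff simp_thms)
qed simp

section \<open>The complex of \<open>cell(n,2)\<close>\<close>

lemma split_face_in_cells:
  assumes "u @ [a, b] # v \<in> cells n 2 (Suc k)"
  shows "u @ [a] # [b] # v \<in> cells n 2 k" "u @ [b] # [a] # v \<in> cells n 2 k"
  using assms by (auto simp: cells_def symbols_def insert_commute)

lemma boundary_closed:
  assumes "c \<in> carrier (chains n 2 (Suc k))"
  shows "boundary c \<in> carrier (chains n 2 k)"
  using assms unfolding carrier_chains_eq_span[of _ _ "Suc k"]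
proof (rule Q.span_induct)
  let ?C = "carrier (chains n 2 k)"
  have sub: "Q.subspace ?C" by (simp add: carrier_chains_eq_span)
  show "Q.subspace {c. boundary c \<in> ?C}"
    unfolding Q.subspace_def
    by (simp add: boundary_add boundary_scale Q.subspace_0[OF sub] Q.subspace_add[OF sub]
        Q.subspace_scale[OF sub])
  fix c :: chain assume "c \<in> (\<lambda>s. Poly_Mapping.single s 1) ` cells n 2 (Suc k)"
  then obtain s where s: "s \<in> cells n 2 (Suc k)" "c = Poly_Mapping.single s 1" by blast
  have "split_pairs s \<subseteq> ?C"
  proof
    fix x assume "x \<in> split_pairs s"
    then obtain u a b v where "s = u @ [a, b] # v"
      and x: "x = Poly_Mapping.single (u @ [a] # [b] # v) 1 - Poly_Mapping.single (u @ [b] # [a] # v) 1"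
      by (auto simp: split_pairs_def)
    then show "x \<in> ?C"
      using split_face_in_cells[of u a b v n k] s(1) unfolding x carrier_chains_eq_span
      by (intro Q.span_diff Q.span_base) auto
  qed
  then have "Q.span (split_pairs s) \<subseteq> ?C" by (rule Q.span_minimal[OF _ sub])
  then show "boundary c \<in> ?C"
    using symbol_boundary_in_split_pairs[OF narrow_cells[OF s(1)]]
    by (auto simp: s(2) boundary_single)
qed

lemma boundary_boundary:
  assumes "c \<in> carrier (chains n 2 k)"
  shows "boundary (boundary c) = 0"
  using assms unfolding carrier_chains_eq_span
proof (rule Q.span_induct)
  show "Q.subspace {c. boundary (boundary c) = 0}"
    by (simp add: Q.subspace_def boundary_add boundary_scale)
  fix c :: chain assume "c \<in> (\<lambda>s. Poly_Mapping.single s 1) ` cells n 2 k"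
  then show "boundary (boundary c) = 0"
    by (auto simp: boundary_single boundary_symbol_boundary narrow_cells)
qed

lemma boundary_relabel:
  assumes "c \<in> carrier (chains n 2 k)" "inj p"
  shows "boundary (relabel p c) = relabel p (boundary c)"
  using assms(1) unfolding carrier_chains_eq_span
proof (rule Q.span_induct)
  show "Q.subspace {c. boundary (relabel p c) = relabel p (boundary c)}"
    by (simp add: Q.subspace_def boundary_add boundary_scale relabel_add relabel_scale)
  fix c :: chain assume "c \<in> (\<lambda>s. Poly_Mapping.single s 1) ` cells n 2 k"
  then show "boundary (relabel p c) = relabel p (boundary c)"
    using assms(2) by (auto simp: boundary_single relabel_symbol_boundary narrow_cells)
qed

lemma map_cells:
  assumes "p permutes {1..n}" "s \<in> cells n w k"
  shows "map (map p) s \<in> cells n w k"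
proof -
  have "distinct (concat (map (map p) s))"
    using assms by (auto simp: cells_def symbols_def distinct_map simp flip: map_concat
        intro: inj_on_subset[OF permutes_inj])
  moreover have "set (concat (map (map p) s)) = {1..n}"
    using assms permutes_image[OF assms(1)] by (simp add: cells_def symbols_def flip: map_concat)
  ultimately show ?thesis
    using assms(2) by (auto simp: cells_def symbols_def)
qed

lemma relabel_closed:
  assumes "p permutes {1..n}" "c \<in> carrier (chains n w k)"
  shows "relabel p c \<in> carrier (chains n w k)"
  using assms(2) unfolding carrier_chains_eq_span
proof (rule Q.span_induct)
  show "Q.subspace {c. relabel p c \<in> Q.span ((\<lambda>s. Poly_Mapping.single s 1) ` cells n w k)}"
    by (auto simp: Q.subspace_def relabel_add relabel_scale
        intro: Q.span_zero Q.span_add Q.span_scale)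
  fix c :: chain assume "c \<in> (\<lambda>s. Poly_Mapping.single s 1) ` cells n w k"
  then show "relabel p c \<in> Q.span ((\<lambda>s. Poly_Mapping.single s 1) ` cells n w k)"
    using map_cells[OF assms(1)] by (auto intro!: Q.span_base)
qed

text \<open>The differential vanishes on coinvariants: the two faces in a split pair are exchanged by the
  transposition of \<open>a\<close> and \<open>b\<close>. The set \<open>N\<close> plays the role of the kernel of a linear map that is
  constant on orbits.\<close>

lemma boundary_in_coinvariant_kernel:
  assumes N: "Q.subspace N"
    and coinv: "\<And>p c. p permutes {1..n} \<Longrightarrow> c - relabel p c \<in> N"
    and c: "c \<in> carrier (chains n 2 k)"
  shows "boundary c \<in> N"
  using c unfolding carrier_chains_eq_span
proof (rule Q.span_induct)
  show "Q.subspace {c. boundary c \<in> N}"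
    unfolding Q.subspace_def
    by (simp add: boundary_add boundary_scale Q.subspace_0[OF N] Q.subspace_add[OF N]
        Q.subspace_scale[OF N])
  fix c :: chain assume "c \<in> (\<lambda>s. Poly_Mapping.single s 1) ` cells n 2 k"
  then obtain s where s: "s \<in> cells n 2 k" "c = Poly_Mapping.single s 1" by blast
  have "split_pairs s \<subseteq> N"
  proof
    fix x assume "x \<in> split_pairs s"
    then obtain u a b v where uv: "s = u @ [a, b] # v"
      and x: "x = Poly_Mapping.single (u @ [a] # [b] # v) 1 - Poly_Mapping.single (u @ [b] # [a] # v) 1"
      by (auto simp: split_pairs_def)
    let ?p = "Transposition.transpose a b"
    have ab: "a \<in> {1..n}" "b \<in> {1..n}"
      using s(1) uv by (auto simp: cells_def symbols_def)
    have fresh: "a \<notin> set g" "b \<notin> set g" if "g \<in> set u \<union> set v" for g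
      using s(1) uv that by (auto simp: cells_def symbols_def)
    have "map (map ?p) w = w" if "set w \<subseteq> set u \<union> set v" for w
      using fresh that by (intro map_idI map_idI transpose_apply_other) auto
    then have "relabel ?p (Poly_Mapping.single (u @ [a] # [b] # v) 1)
        = Poly_Mapping.single (u @ [b] # [a] # v) 1"
      by simp
    then show "x \<in> N"
      using coinv[OF permutes_swap_id[OF ab], of "Poly_Mapping.single (u @ [a] # [b] # v) 1"]
      by (simp add: x)
  qed
  then have "Q.span (split_pairs s) \<subseteq> N" by (rule Q.span_minimal[OF _ N])
  then show "boundary c \<in> N"
    using symbol_boundary_in_split_pairs[OF narrow_cells[OF s(1)]]
    by (auto simp: s(2) boundary_single)
qed

definition invariant_chains :: "nat \<Rightarrow> nat \<Rightarrow> chain set" where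
  "invariant_chains n k =
     {v \<in> carrier (chains n 2 k). \<forall>p. p permutes {1..n} \<longrightarrow> relabel p v = v}"

text \<open>Pairing with an invariant chain is constant on orbits, since relabelling is isometric.\<close>

lemma invariant_chain_orthogonal:
  assumes "v \<in> invariant_chains n k" "c \<in> carrier (chains n 2 j)"
  shows "pairing v (boundary c) = 0"
proof -
  have "Q.subspace {x. pairing v x = 0}"
    by (simp add: Q.subspace_def pairing_add_right pairing_scale_right)
  moreover have "pairing v (x - relabel p x) = 0" if p: "p permutes {1..n}" for p x
    using pairing_relabel[OF permutes_inj[OF p], of v x] assms(1) p
    by (simp add: pairing_diff_right invariant_chains_def)
  ultimately have "boundary c \<in> {x. pairing v x = 0}"
    by (intro boundary_in_coinvariant_kernel[OF _ _ assms(2)]) auto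
  then show ?thesis by simp
qed

text \<open>Averaging over the symmetric group is constant on orbits, so it kills boundaries; but on the
  boundary of an invariant chain it is multiplication by the order of the group.\<close>

lemma invariant_chain_cycle:
  assumes "v \<in> invariant_chains n k"
  shows "boundary v = 0"
proof -
  let ?G = "{p. p permutes {1..n}}"
  define avg where "avg c = (\<Sum>p\<in>?G. relabel p c)" for c
  have fin: "finite ?G" by (rule finite_permutations) simp
  have v: "v \<in> carrier (chains n 2 k)" using assms by (simp add: invariant_chains_def)
  have "avg (boundary v) = (\<Sum>p\<in>?G. boundary (relabel p v))"
    unfolding avg_def by (intro sum.cong refl) (simp add: boundary_relabel[OF v] permutes_inj)
  also have "\<dots> = (\<Sum>p\<in>?G. boundary v)"
    using assms by (intro sum.cong refl) (simp add: invariant_chains_def)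
  also have "\<dots> = scale (of_nat (card ?G)) (boundary v)"
    by (rule poly_mapping_eqI) (simp add: lookup_sum)
  finally have avg_eq: "avg (boundary v) = scale (of_nat (card ?G)) (boundary v)" .
  have "boundary v \<in> {c. avg c = 0}"
  proof (rule boundary_in_coinvariant_kernel[OF _ _ v])
    show "Q.subspace {c. avg c = 0}"
      by (simp add: Q.subspace_def avg_def relabel_add relabel_scale sum.distrib
          flip: Q.scale_sum_right)
    fix q c assume q: "q permutes {1..n}"
    have "avg (relabel q c) = (\<Sum>p\<in>?G. relabel (p \<circ> q) c)"
      by (simp add: avg_def relabel_comp)
    also have "\<dots> = avg c"
      unfolding avg_def by (rule sum_permutations_compose_right[OF q, symmetric])
    finally show "c - relabel q c \<in> {c. avg c = 0}"
      by (simp add: avg_def relabel_diff sum_subtractf)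
  qed
  then have "scale (of_nat (card ?G)) (boundary v) = 0" using avg_eq by simp
  moreover have "card ?G \<noteq> 0" using fin permutes_id[of "{1..n}"] by (auto simp del: permutes_id)
  ultimately show ?thesis by simp
qed


section \<open>Homology as the space of harmonic chains\<close>

definition coset :: "('s \<Rightarrow>\<^sub>0 rat) set \<Rightarrow> ('s \<Rightarrow>\<^sub>0 rat) \<Rightarrow> ('s \<Rightarrow>\<^sub>0 rat) set" where
  "coset B x = (\<lambda>b. b + x) ` B"

lemma coset_eq_iff:
  assumes "Q.subspace B"
  shows "coset B x = coset B y \<longleftrightarrow> x - y \<in> B"
proof
  assume "coset B x = coset B y"
  moreover have "x \<in> coset B x"
    unfolding coset_def by (rule image_eqI[of _ _ 0]) (simp_all add: Q.subspace_0[OF assms])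
  ultimately show "x - y \<in> B" by (auto simp: coset_def)
next
  assume *: "x - y \<in> B"
  have "coset B u \<subseteq> coset B v" if "u - v \<in> B" for u v
  proof
    fix z assume "z \<in> coset B u"
    then obtain b where "b \<in> B" "z = b + u" by (auto simp: coset_def)
    then show "z \<in> coset B v"
      using Q.subspace_add[OF assms, of b "u - v"] that
      unfolding coset_def by (intro image_eqI[of _ _ "b + (u - v)"]) (auto simp: add_diff_eq)
  qed
  then show "coset B x = coset B y"
    using * Q.subspace_neg[OF assms *] by (simp add: subset_antisym)
qed

lemma quotient_module_simps:
  assumes B: "Q.subspace B"
  shows "carrier (quotient_module (subspace_module Z) B) = coset B ` Z"
    and "\<zero>\<^bsub>quotient_module (subspace_module Z) B\<^esub> = coset B 0"
    and "coset B x \<oplus>\<^bsub>quotient_module (subspace_module Z) B\<^esub> coset B y = coset B (x + y)"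
    and "r \<odot>\<^bsub>quotient_module (subspace_module Z) B\<^esub> coset B x = coset B (scale r x)"
proof -
  let ?M = "subspace_module Z"
  have rc: "X +>\<^bsub>?M\<^esub> a = coset X a" for X a
    by (auto simp: a_r_coset_def' coset_def)
  show "carrier (quotient_module ?M B) = coset B ` Z"
    by (auto simp: quotient_module_def A_RCOSETS_def' rc)
  show "\<zero>\<^bsub>quotient_module ?M B\<^esub> = coset B 0"
    by (simp add: quotient_module_def coset_def)
  have "set_add ?M (coset B x) (coset B y) = coset B (x + y)"
  proof
    show "set_add ?M (coset B x) (coset B y) \<subseteq> coset B (x + y)"
    proof
      fix z assume "z \<in> set_add ?M (coset B x) (coset B y)"
      then obtain b c where "b \<in> B" "c \<in> B" "z = (b + x) + (c + y)"
        by (auto simp: set_add_def' coset_def)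
      then show "z \<in> coset B (x + y)"
        unfolding coset_def
        by (intro image_eqI[of _ _ "b + c"]) (auto simp: Q.subspace_add[OF B] algebra_simps)
    qed
    show "coset B (x + y) \<subseteq> set_add ?M (coset B x) (coset B y)"
    proof
      fix z assume "z \<in> coset B (x + y)"
      then obtain b where "b \<in> B" "z = (b + x) + (0 + y)" by (auto simp: coset_def add_ac)
      then show "z \<in> set_add ?M (coset B x) (coset B y)"
        using Q.subspace_0[OF B] unfolding set_add_def' coset_def by fastforce
    qed
  qed
  then show "coset B x \<oplus>\<^bsub>quotient_module ?M B\<^esub> coset B y = coset B (x + y)"
    by (simp add: quotient_module_def)
  have "coset B (scale r u) = coset B (scale r x)" if "u \<in> coset B x" for u
  proof -
    obtain b where "b \<in> B" "u = b + x" using \<open>u \<in> coset B x\<close> by (auto simp: coset_def)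
    then show ?thesis
      by (simp add: coset_eq_iff[OF B] scale_add Q.subspace_scale[OF B])
  qed
  moreover have "coset B x \<noteq> {}" using Q.subspace_0[OF B] by (auto simp: coset_def)
  ultimately have "(\<Union>u\<in>coset B x. coset B (scale r u)) = coset B (scale r x)" by auto
  then show "r \<odot>\<^bsub>quotient_module ?M B\<^esub> coset B x = coset B (scale r x)"
    by (simp add: quotient_module_def rc)
qed

lemma subspace_chains: "Q.subspace (carrier (chains n w k))"
  by (simp add: carrier_chains_eq_span)

lemma homology_eq: "homology n w k = quotient_module (subspace_module (cycles n w k)) (boundaries n w k)"
  by (simp add: homology_def chains_def subspace_module_def free_module_def)

lemma subspace_cycles: "Q.subspace (cycles n w k)"
  using subspace_chains[of n w k]
  by (simp add: cycles_def Q.subspace_def boundary_add boundary_scale)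

lemma subspace_boundaries: "Q.subspace (boundaries n w k)"
proof (rule Q.subspaceI)
  note C = subspace_chains[of n w "k + 1"]
  show "0 \<in> boundaries n w k"
    unfolding boundaries_def by (rule image_eqI[OF _ Q.subspace_0[OF C]]) simp
  fix x assume "x \<in> boundaries n w k"
  then obtain c where c: "c \<in> carrier (chains n w (k + 1))" "x = boundary c"
    by (auto simp: boundaries_def)
  show "scale r x \<in> boundaries n w k" for r
    using c Q.subspace_scale[OF C] by (auto simp: boundaries_def simp flip: boundary_scale)
  fix y assume "y \<in> boundaries n w k"
  then obtain d where "d \<in> carrier (chains n w (k + 1))" "y = boundary d"
    by (auto simp: boundaries_def)
  with c show "x + y \<in> boundaries n w k"
    using Q.subspace_add[OF C] by (auto simp: boundaries_def simp flip: boundary_add)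
qed

lemma boundaries_subset_cycles: "boundaries n 2 k \<subseteq> cycles n 2 k"
  using boundary_closed boundary_boundary by (auto simp: boundaries_def cycles_def)

lemma relabel_cycles:
  assumes "p permutes {1..n}" "z \<in> cycles n 2 k"
  shows "relabel p z \<in> cycles n 2 k"
  using assms(2) relabel_closed[OF assms(1)] boundary_relabel[of z n k, OF _ permutes_inj[OF assms(1)]]
  by (simp add: cycles_def)

lemma relabel_boundaries:
  assumes "p permutes {1..n}" "b \<in> boundaries n 2 k"
  shows "relabel p b \<in> boundaries n 2 k"
proof -
  obtain c where c: "c \<in> carrier (chains n 2 (k + 1))" "b = boundary c"
    using assms(2) by (auto simp: boundaries_def)
  then have "relabel p b = boundary (relabel p c)"
    by (simp add: boundary_relabel permutes_inj[OF assms(1)])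
  then show ?thesis using relabel_closed[OF assms(1) c(1)] by (auto simp: boundaries_def)
qed

lemma relabel_inv:
  assumes "p permutes S"
  shows "relabel p (relabel (inv' p) c) = c" "relabel (inv' p) (relabel p c) = c"
  using assms by (simp_all flip: relabel_comp add: permutes_inv_o)

lemma relabel_coset:
  assumes p: "p permutes {1..n}"
  shows "relabel p ` coset (boundaries n 2 k) x = coset (boundaries n 2 k) (relabel p x)"
proof -
  have "relabel p ` boundaries n 2 k = boundaries n 2 k"
  proof
    show "boundaries n 2 k \<subseteq> relabel p ` boundaries n 2 k"
    proof
      fix b assume "b \<in> boundaries n 2 k"
      then have "relabel (inv' p) b \<in> boundaries n 2 k"
        by (rule relabel_boundaries[OF permutes_inv[OF p]])
      then show "b \<in> relabel p ` boundaries n 2 k"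
        using relabel_inv(1)[OF p, of b] by (metis imageI)
    qed
  qed (use relabel_boundaries[OF p] in auto)
  then have "(\<lambda>b. b + relabel p x) ` relabel p ` boundaries n 2 k = coset (boundaries n 2 k) (relabel p x)"
    by (simp add: coset_def)
  then show ?thesis by (simp add: coset_def image_image relabel_add)
qed

text \<open>The orthogonal complement of the boundaries within the cycles: each homology class has
  exactly one harmonic representative.\<close>

definition harmonic_chains :: "nat \<Rightarrow> nat \<Rightarrow> chain set" where
  "harmonic_chains n k = {z \<in> cycles n 2 k. \<forall>b\<in>boundaries n 2 k. pairing z b = 0}"

lemma subspace_harmonic_chains: "Q.subspace (harmonic_chains n k)"
  using subspace_cycles[of n 2 k]
  by (simp add: harmonic_chains_def Q.subspace_def pairing_add_left pairing_scale_left)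

lemma orthogonal_harmonic_chains:
  "orthogonal_representation (sym_group n) (harmonic_chains n k)
     ((\<lambda>s. Poly_Mapping.single s 1) ` cells n 2 k) relabel"
proof -
  interpret G: group "sym_group n" by (rule sym_group_is_group)
  show ?thesis
  proof
    show "Q.subspace (harmonic_chains n k)" by (rule subspace_harmonic_chains)
    show "finite ((\<lambda>s. Poly_Mapping.single s (1 :: rat)) ` cells n 2 k)" by (simp add: finite_cells)
    show "harmonic_chains n k \<subseteq> Q.span ((\<lambda>s. Poly_Mapping.single s 1) ` cells n 2 k)"
      by (auto simp: harmonic_chains_def cycles_def simp flip: carrier_chains_eq_span)
    show "pairing (relabel p v) (relabel p w) = pairing v w" if "p \<in> carrier (sym_group n)" for p v w
      using that by (intro pairing_relabel) (auto simp: sym_group_carrier permutes_inj)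
    fix p v assume p: "p \<in> carrier (sym_group n)" and v: "v \<in> harmonic_chains n k"
    then have perm: "p permutes {1..n}" by (simp add: sym_group_carrier)
    have "pairing (relabel p v) b = 0" if b: "b \<in> boundaries n 2 k" for b
    proof -
      have "pairing (relabel p v) b = pairing (relabel p v) (relabel p (relabel (inv' p) b))"
        by (simp add: relabel_inv[OF perm])
      also have "\<dots> = pairing v (relabel (inv' p) b)"
        by (rule pairing_relabel[OF permutes_inj[OF perm]])
      also have "\<dots> = 0"
        using v relabel_boundaries[OF permutes_inv[OF perm] b] by (simp add: harmonic_chains_def)
      finally show ?thesis .
    qed
    then show "relabel p v \<in> harmonic_chains n k"
      using v relabel_cycles[OF perm] by (simp add: harmonic_chains_def)
  qed (simp_all add: relabel_add relabel_scale sym_group_one sym_group_mult relabel_comp)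
qed

text \<open>Injectivity: a harmonic boundary is orthogonal to itself. Surjectivity: subtract from a cycle
  its orthogonal projection to the boundaries.\<close>

lemma harmonic_isomorphism:
  "representation_isomorphism rat_field (subspace_module (harmonic_chains n k)) (sym_group n) relabel
     (homology n 2 k) homology_action (coset (boundaries n 2 k))"
proof -
  interpret H: orthogonal_representation "sym_group n" "harmonic_chains n k"
    "(\<lambda>s. Poly_Mapping.single s 1) ` cells n 2 k" relabel
    by (rule orthogonal_harmonic_chains)
  let ?B = "boundaries n 2 k" and ?Z = "cycles n 2 k" and ?H = "harmonic_chains n k"
  note B = subspace_boundaries[of n 2 k]
  note simps = quotient_module_simps[OF B, of ?Z, folded homology_eq]
  show ?thesis
  proof
    have "inj_on (coset ?B) ?H"
    proof (rule inj_onI)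
      fix x y assume "x \<in> ?H" "y \<in> ?H" "coset ?B x = coset ?B y"
      then have "x - y \<in> ?B" "x - y \<in> ?H"
        using Q.subspace_diff[OF subspace_harmonic_chains] by (auto simp: coset_eq_iff[OF B])
      then have "pairing (x - y) (x - y) = 0" by (simp add: harmonic_chains_def)
      then show "x = y" by simp
    qed
    moreover have "coset ?B ` ?Z = coset ?B ` ?H"
    proof
      show "coset ?B ` ?Z \<subseteq> coset ?B ` ?H"
      proof
        fix X assume "X \<in> coset ?B ` ?Z"
        then obtain z where z: "z \<in> ?Z" "X = coset ?B z" by blast
        obtain b where b: "b \<in> ?B" "\<And>x. x \<in> ?B \<Longrightarrow> pairing (z - b) x = 0"
        proof (rule orthogonal_projection[of ?B _ z])
          show "?B \<subseteq> Q.span ((\<lambda>s. Poly_Mapping.single s 1) ` cells n 2 k)"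
            using boundaries_subset_cycles[of n k]
            by (auto simp: cycles_def simp flip: carrier_chains_eq_span)
        qed (use B finite_cells in auto)
        have "z - b \<in> ?Z"
          using Q.subspace_diff[OF subspace_cycles z(1)] b(1) boundaries_subset_cycles by blast
        then have "z - b \<in> ?H" using b(2) by (simp add: harmonic_chains_def)
        moreover have "X = coset ?B (z - b)"
          using z(2) b(1) by (simp add: coset_eq_iff[OF B])
        ultimately show "X \<in> coset ?B ` ?H" by blast
      qed
    qed (auto simp: harmonic_chains_def)
    ultimately show "bij_betw (coset ?B) (carrier (subspace_module ?H)) (carrier (homology n 2 k))"
      by (simp add: bij_betw_def simps)
  qed (simp_all add: simps homology_action_def sym_group_carrier relabel_coset)
qed


section \<open>Counting orbits of cells\<close>

text \<open>The composition of \<open>n\<close> formed by the block lengths is a complete invariant of the orbit of a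
  cell, so the shapes stand for the orbits.\<close>

definition shapes :: "nat \<Rightarrow> nat \<Rightarrow> nat list set" where
  "shapes n k = map length ` cells n 2 k"

lemma ex_permutation_map:
  assumes "distinct xs" "distinct ys" "set xs = A" "set ys = A"
  shows "\<exists>p. p permutes A \<and> map p xs = ys"
proof -
  have len: "length xs = length ys"
    using assms by (metis distinct_card)
  have bx: "bij_betw ((!) xs) {..<length xs} A" and by': "bij_betw ((!) ys) {..<length xs} A"
    using assms len by (auto intro!: bij_betw_nth)
  let ?q = "\<lambda>x. ys ! inv_into {..<length xs} ((!) xs) x"
  let ?p = "\<lambda>x. if x \<in> A then ?q x else x"
  have "bij_betw ?q A A"
    using bij_betw_trans[OF bij_betw_inv_into[OF bx] by'] by (simp add: comp_def)
  then have "bij_betw ?p A A" by (simp cong: bij_betw_cong)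
  then have "?p permutes A" by (rule bij_imp_permutes) simp
  moreover have "map ?p xs = ys"
  proof (rule nth_equalityI)
    fix i assume "i < length (map ?p xs)"
    then have i: "i < length xs" by simp
    have "inv_into {..<length xs} ((!) xs) (xs ! i) = i"
      using bij_betw_inv_into_left[OF bx] i by simp
    then show "map ?p xs ! i = ys ! i" using i assms(3) by auto
  qed (simp add: len)
  ultimately show ?thesis by blast
qed

text \<open>The permutation is the one that takes the word \<open>concat s\<close> to the word \<open>concat t\<close>; equal block
  lengths make it respect the bars.\<close>

lemma same_shape_imp_same_orbit:
  assumes "s \<in> symbols n" "t \<in> symbols n" "map length s = map length t"
  shows "\<exists>p. p permutes {1..n} \<and> map (map p) s = t"
proof -
  obtain p where p: "p permutes {1..n}" "map p (concat s) = concat t"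
    using ex_permutation_map[of "concat s" "concat t" "{1..n}"] assms
    by (auto simp: symbols_def simp del: set_concat)
  have "map length (map (map p) s) = map length t"
    using assms(3) by (simp add: comp_def)
  moreover have "concat (map (map p) s) = concat t" using p(2) by (simp add: map_concat)
  ultimately have "map (map p) s = t"
  proof (induction t arbitrary: s)
    case (Cons b t)
    then show ?case by (cases s) auto
  qed simp
  with p(1) show ?thesis by blast
qed

lemma ex_concat_of_lengths:
  "length xs = sum_list l \<Longrightarrow> \<exists>s. concat s = xs \<and> map length s = l"
proof (induction l arbitrary: xs)
  case (Cons m l)
  then obtain s where "concat s = drop m xs" "map length s = l"
    by (metis add_diff_cancel_left' length_drop sum_list.Cons)
  then have "concat (take m xs # s) = xs \<and> map length (take m xs # s) = m # l"
    using Cons.prems by simp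
  then show ?case by (rule exI)
qed simp

text \<open>Every composition of \<open>n\<close> into parts \<open>1\<close> and \<open>2\<close> is realised by cutting the word
  \<open>1 2 \<dots> n\<close>.\<close>

lemma shapes_eq:
  "shapes n k = {l. set l \<subseteq> {1, 2} \<and> length l + k = n \<and> sum_list l = n}"
proof
  show "shapes n k \<subseteq> {l. set l \<subseteq> {1, 2} \<and> length l + k = n \<and> sum_list l = n}"
  proof
    fix l assume "l \<in> shapes n k"
    then obtain s where s: "s \<in> cells n 2 k" "l = map length s" by (auto simp: shapes_def)
    have "sum_list l = length (concat s)" by (simp add: s(2) length_concat)
    also have "\<dots> = card (set (concat s))"
      using s(1) by (intro distinct_card[symmetric]) (simp add: cells_def symbols_def)
    also have "\<dots> = n" using s(1) by (simp add: cells_def symbols_def del: set_concat)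
    finally have "sum_list l = n" .
    moreover have "length b = 1 \<or> length b = 2" if "b \<in> set s" for b
    proof -
      have "length b \<le> 2" "b \<noteq> []" using s(1) that by (auto simp: cells_def symbols_def)
      then have "length b \<noteq> 0" by simp
      then show ?thesis using \<open>length b \<le> 2\<close> by linarith
    qed
    ultimately show "l \<in> {l. set l \<subseteq> {1, 2} \<and> length l + k = n \<and> sum_list l = n}"
      using s by (auto simp: cells_def)
  qed
  show "{l. set l \<subseteq> {1, 2} \<and> length l + k = n \<and> sum_list l = n} \<subseteq> shapes n k"
  proof
    fix l assume "l \<in> {l. set l \<subseteq> {1, 2} \<and> length l + k = n \<and> sum_list l = n}"
    then have l: "set l \<subseteq> {1, 2}" "length l + k = n" "sum_list l = n" by auto
    have "length [1..<Suc n] = sum_list l" using l(3) by (simp del: upt_Suc)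
    then obtain s where s: "concat s = [1..<Suc n]" "map length s = l"
      using ex_concat_of_lengths by blast
    have len: "length b = 1 \<or> length b = 2" if "b \<in> set s" for b
    proof -
      have "length b \<in> set l" using that by (auto simp flip: s(2))
      then show ?thesis using l(1) by auto
    qed
    have "[] \<notin> set s" using len[of "[]"] by auto
    moreover have "\<forall>b\<in>set s. length b \<le> 2"
    proof
      fix b assume "b \<in> set s"
      then show "length b \<le> 2" using len[of b] by linarith
    qed
    moreover have "length s + k = n" using l(2) by (simp flip: s(2))
    moreover have "distinct (concat s)" "set (concat s) = {1..n}"
      unfolding s(1) by (simp_all only: distinct_upt set_upt atLeastLessThanSuc_atLeastAtMost)
    ultimately have "s \<in> cells n 2 k"
      unfolding cells_def symbols_def by blast
    then show "l \<in> shapes n k" using s(2) by (auto simp: shapes_def)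
  qed
qed

text \<open>Pascal's rule, according to whether the first entry is \<open>1\<close> or \<open>2\<close>.\<close>

lemma card_lists_1_2:
  "card {l. set l \<subseteq> {1, 2} \<and> length l = r \<and> sum_list l = r + k} = r choose k"
proof (induction r arbitrary: k)
  case 0
  have "{l :: nat list. set l \<subseteq> {1, 2} \<and> length l = 0 \<and> sum_list l = 0 + k} = (if k = 0 then {[]} else {})"
    by auto
  then show ?case by (cases k) auto
next
  case (Suc r)
  let ?L = "\<lambda>r k. {l :: nat list. set l \<subseteq> {1, 2} \<and> length l = r \<and> sum_list l = r + k}"
  have fin: "finite (?L r k)" for k
    by (rule finite_subset[OF _ finite_lists_length_eq[of "{1, 2}" r]]) auto
  show ?case
  proof (cases k)
    case 0
    have ge: "sum_list l \<ge> length l" if "set l \<subseteq> {1, 2}" for l :: "nat list"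
      using that by (induction l) auto
    have "?L (Suc r) 0 = (#) 1 ` ?L r 0"
    proof
      show "?L (Suc r) 0 \<subseteq> (#) 1 ` ?L r 0"
      proof
        fix l assume "l \<in> ?L (Suc r) 0"
        then obtain m l' where l: "l = m # l'" "m = 1 \<or> m = 2" "set l' \<subseteq> {1, 2}"
          "length l' = r" "m + sum_list l' = Suc r"
          by (auto simp: length_Suc_conv)
        with ge[OF l(3)] show "l \<in> (#) 1 ` ?L r 0" by auto
      qed
    qed auto
    then have "card (?L (Suc r) 0) = card (?L r 0)" by (simp add: card_image)
    then show ?thesis using Suc.IH[of 0] 0 by simp
  next
    case k: (Suc j)
    have union: "?L (Suc r) (Suc j) = (#) 1 ` ?L r (Suc j) \<union> (#) 2 ` ?L r j"
      by (auto simp: length_Suc_conv image_iff)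
    have "card (?L (Suc r) (Suc j)) = card (?L r (Suc j)) + card (?L r j)"
      unfolding union using fin[of "Suc j"] fin[of j]
      by (subst card_Un_disjoint[OF finite_imageI finite_imageI]) (auto simp: card_image)
    then show ?thesis
      unfolding k Suc.IH binomial_Suc_Suc by (simp only: add.commute)
  qed
qed

lemma card_shapes: "card (shapes n k) = (n - k) choose k"
proof (cases "k \<le> n")
  case True
  then have "shapes n k = {l. set l \<subseteq> {1, 2} \<and> length l = n - k \<and> sum_list l = (n - k) + k}"
    by (auto simp: shapes_eq)
  then show ?thesis by (simp only: card_lists_1_2)
next
  case False
  then have "shapes n k = {}" by (auto simp: shapes_eq)
  then show ?thesis using False by simp
qed

definition orbit_sum :: "nat \<Rightarrow> nat \<Rightarrow> nat list \<Rightarrow> chain" where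
  "orbit_sum n k l = (\<Sum>s\<in>{s \<in> cells n 2 k. map length s = l}. Poly_Mapping.single s 1)"

lemma lookup_orbit_sum:
  "Poly_Mapping.lookup (orbit_sum n k l) s = (if s \<in> cells n 2 k \<and> map length s = l then 1 else 0)"
proof -
  have "finite {s \<in> cells n 2 k. map length s = l}" using finite_cells by simp
  then show ?thesis
    by (auto simp: orbit_sum_def lookup_sum lookup_single when_def)
qed

lemma lookup_relabel:
  assumes "inj p"
  shows "Poly_Mapping.lookup (relabel p c) (map (map p) s) = Poly_Mapping.lookup c s"
  using pairing_relabel[OF assms, of c "Poly_Mapping.single s 1"] by simp

lemma orbit_sum_invariant: "orbit_sum n k l \<in> invariant_chains n k"
proof -
  have "relabel p (orbit_sum n k l) = orbit_sum n k l" if p: "p permutes {1..n}" for p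
  proof (rule poly_mapping_eqI)
    fix s
    let ?t = "map (map (inv' p)) s"
    have s: "map (map p) ?t = s" by (simp add: permutes_inv_o[OF p])
    have "Poly_Mapping.lookup (relabel p (orbit_sum n k l)) s = Poly_Mapping.lookup (orbit_sum n k l) ?t"
      using lookup_relabel[OF permutes_inj[OF p], of _ ?t] by (simp only: s)
    moreover have "?t \<in> cells n 2 k \<longleftrightarrow> s \<in> cells n 2 k"
      using map_cells[OF p, of ?t] map_cells[OF permutes_inv[OF p], of s] by (metis s)
    ultimately show "Poly_Mapping.lookup (relabel p (orbit_sum n k l)) s
        = Poly_Mapping.lookup (orbit_sum n k l) s"
      by (simp add: lookup_orbit_sum comp_def)
  qed
  moreover have "Poly_Mapping.keys (orbit_sum n k l) \<subseteq> cells n 2 k"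
    by (auto simp: in_keys_iff lookup_orbit_sum split: if_splits)
  ultimately show ?thesis by (simp add: invariant_chains_def carrier_chains)
qed

text \<open>The orbit sums are a basis of the invariants: their supports are disjoint and nonempty, and
  the coefficients of an invariant chain are constant on orbits.\<close>

lemma dim_invariant_chains: "Q.dim (invariant_chains n k) = card (shapes n k)"
proof -
  let ?e = "orbit_sum n k"
  define rep where "rep l = (SOME s. s \<in> cells n 2 k \<and> map length s = l)" for l
  have rep: "rep l \<in> cells n 2 k \<and> map length (rep l) = l" if "l \<in> shapes n k" for l
    unfolding rep_def by (rule someI_ex) (use that in \<open>auto simp: shapes_def\<close>)
  have lookup_rep: "Poly_Mapping.lookup (?e l) (rep m) = (if l = m then 1 else 0)"
    if "m \<in> shapes n k" for l m
    using rep[OF that] by (auto simp: lookup_orbit_sum)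
  have inj: "inj_on ?e (shapes n k)"
    by (rule inj_onI) (metis lookup_rep zero_neq_one)
  have fin: "finite (shapes n k)" by (simp add: shapes_def finite_cells)
  have "Q.dim (invariant_chains n k) = card (?e ` shapes n k)"
  proof (rule Q.dim_unique[OF _ _ _ refl])
    show "?e ` shapes n k \<subseteq> invariant_chains n k" using orbit_sum_invariant by auto
    show "Q.independent (?e ` shapes n k)"
    proof (rule Q.independent_if_scalars_zero)
      fix r x assume 0: "(\<Sum>x\<in>?e ` shapes n k. scale (r x) x) = 0" and x: "x \<in> ?e ` shapes n k"
      then obtain m where m: "m \<in> shapes n k" "x = ?e m" by blast
      have "0 = Poly_Mapping.lookup (\<Sum>x\<in>?e ` shapes n k. scale (r x) x) (rep m)"
        using 0 by simp
      also have "\<dots> = (\<Sum>l\<in>shapes n k. r (?e l) * (if l = m then 1 else 0))"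
        by (simp add: sum.reindex[OF inj] lookup_sum lookup_rep[OF m(1)])
      also have "\<dots> = r x" using m fin by (simp add: if_distrib[of "(*) _"] cong: if_cong)
      finally show "r x = 0" by simp
    qed (simp add: fin)
    show "invariant_chains n k \<subseteq> Q.span (?e ` shapes n k)"
    proof
      fix v assume v: "v \<in> invariant_chains n k"
      have "v = (\<Sum>l\<in>shapes n k. scale (Poly_Mapping.lookup v (rep l)) (?e l))"
      proof (rule poly_mapping_eqI)
        fix s
        have "Poly_Mapping.lookup (\<Sum>l\<in>shapes n k. scale (Poly_Mapping.lookup v (rep l)) (?e l)) s
            = (\<Sum>l\<in>shapes n k. if l = map length s \<and> s \<in> cells n 2 k
                then Poly_Mapping.lookup v (rep l) else 0)"
          by (simp add: lookup_sum lookup_orbit_sum) (intro sum.cong, auto)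
        also have "\<dots> = (if s \<in> cells n 2 k then Poly_Mapping.lookup v (rep (map length s)) else 0)"
          using fin by (auto simp: shapes_def)
        also have "\<dots> = Poly_Mapping.lookup v s"
        proof (cases "s \<in> cells n 2 k")
          case True
          let ?r = "rep (map length s)"
          have "?r \<in> cells n 2 k" "map length ?r = map length s"
            using rep True by (auto simp: shapes_def)
          then obtain p where p: "p permutes {1..n}" "map (map p) ?r = s"
            using same_shape_imp_same_orbit[of ?r n s] True by (auto simp: cells_def)
          then have "Poly_Mapping.lookup v s = Poly_Mapping.lookup v ?r"
            using lookup_relabel[OF permutes_inj[OF p(1)], of v ?r] v
            by (simp add: invariant_chains_def)
          then show ?thesis using True by simp
        next
          case False
          then show ?thesis using v by (auto simp: invariant_chains_def carrier_chains in_keys_iff)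
        qed
        finally show "Poly_Mapping.lookup v s = Poly_Mapping.lookup
            (\<Sum>l\<in>shapes n k. scale (Poly_Mapping.lookup v (rep l)) (?e l)) s" ..
      qed
      also have "\<dots> \<in> Q.span (?e ` shapes n k)"
        by (intro Q.span_sum Q.span_scale Q.span_base) auto
      finally show "v \<in> Q.span (?e ` shapes n k)" .
    qed
  qed
  then show ?thesis by (simp add: card_image[OF inj])
qed


section \<open>The multiplicity of the trivial representation\<close>

text \<open>Every invariant chain is harmonic, so the invariant part of homology is the whole invariant
  part of the chain complex.\<close>

lemma invariants_harmonic_chains:
  "{v \<in> harmonic_chains n k. \<forall>p\<in>carrier (sym_group n). relabel p v = v} = invariant_chains n k"
proof
  show "invariant_chains n k \<subseteq> {v \<in> harmonic_chains n k. \<forall>p\<in>carrier (sym_group n). relabel p v = v}"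
  proof
    fix v assume v: "v \<in> invariant_chains n k"
    then have "v \<in> cycles n 2 k"
      using invariant_chain_cycle by (simp add: cycles_def invariant_chains_def)
    moreover have "\<forall>b\<in>boundaries n 2 k. pairing v b = 0"
      using invariant_chain_orthogonal[OF v] by (auto simp: boundaries_def)
    ultimately show "v \<in> {v \<in> harmonic_chains n k. \<forall>p\<in>carrier (sym_group n). relabel p v = v}"
      using v by (simp add: harmonic_chains_def invariant_chains_def sym_group_carrier)
  qed
  show "{v \<in> harmonic_chains n k. \<forall>p\<in>carrier (sym_group n). relabel p v = v} \<subseteq> invariant_chains n k"
  proof
    fix v assume "v \<in> {v \<in> harmonic_chains n k. \<forall>p\<in>carrier (sym_group n). relabel p v = v}"
    then have "v \<in> carrier (chains n 2 k)" "\<And>p. p permutes {1..n} \<Longrightarrow> relabel p v = v"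
      by (simp_all add: harmonic_chains_def cycles_def sym_group_carrier)
    then show "v \<in> invariant_chains n k" by (simp add: invariant_chains_def)
  qed
qed

theorem corollary6p6:
  fixes n k :: nat
  assumes "n \<ge> 1"
  shows "occurs_with_multiplicity rat_field (sym_group n)
           trivial_rep_space trivial_action
           (homology n 2 k) homology_action
           (if n \<ge> 2 * k then (n - k) choose k else 0)"
proof -
  interpret H: orthogonal_representation "sym_group n" "harmonic_chains n k"
    "(\<lambda>s. Poly_Mapping.single s 1) ` cells n 2 k" relabel
    by (rule orthogonal_harmonic_chains)
  interpret iso: representation_isomorphism rat_field "subspace_module (harmonic_chains n k)"
    "sym_group n" relabel "homology n 2 k" homology_action "coset (boundaries n 2 k)"
    by (rule harmonic_isomorphism)
  have "Q.dim H.invariants = (n - k) choose k"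
    by (simp add: H.invariants_def invariants_harmonic_chains dim_invariant_chains card_shapes)
  \<comment> \<open>For \<open>n < 2 * k\<close> the truncated difference \<open>n - k\<close> is less than \<open>k\<close>.\<close>
  also have "\<dots> = (if n \<ge> 2 * k then (n - k) choose k else 0)"
    by (auto intro: binomial_eq_0)
  finally show ?thesis
    using iso.multiplicity_transport[OF H.trivial_multiplicity] by simp
qed

end
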